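(* Let $s,t\ge1$, $n>s+t$ and $N=n+2s+t$. Let $\beta_{1,3}(s,t,n)$ be the number of continuous multiline queues of type $(s,t,n-s-t)$ with the largest entry $N$ in the last row and exactly one wrapping from the second row to the third row, whose projected word $\omega$ has $\omega_1=1$ and $\omega_2=3$. Then $$\beta_{1,3}(s,t,n)=\binom{N-1}{s-2}f_{(n-1,s+t)}.$$
   Context: A continuous multiline queue of type $(s,t,n-s-t)$ is a three-row array whose rows are strictly increasing sequences $a_1<\cdots<a_s$, $b_1<\cdots<b_{s+t}$, $c_1<\cdots<c_n$, whose $N$ entries are exactly $1,\ldots,N$, each once. Bully path procedure: initially all entries are available. First, each entry of row 1 starts a bully path; then each still-available entry of row 2 starts a bully path. An entry $x$ on a path bullies the smallest available entry of the next row larger than $x$, or, if there is none, the smallest available entry of the next row (a wrapping from that row to the next); bullied entries become unavailable and the path continues to row 3. Endpoints of paths starting in row 1 get label 1, those starting in row 2 get label 2, remaining entries of row 3 get label 3. The projected word is $\omega=(\omega_1,\ldots,\omega_n)$, $\omega_k$ the label of $c_k$. $f_{(a,b)}$ is the number of standard Young tableaux of shape $(a,b)$, equal to $\frac{a-b+1}{a+1}\binom{a+b}{a}$ for $a\ge b\ge0$. Binomial coefficients $\binom{x}{k}$ with $k<0$ are $0$. *)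

theory Defs
  imports Complex_Main
begin

definition is_cmlq :: "nat \<Rightarrow> nat \<Rightarrow> nat \<Rightarrow> nat list \<times> nat list \<times> nat list \<Rightarrow> bool" where
  "is_cmlq s t u = (\<lambda>(as, bs, cs).
     length as = s \<and> length bs = s + t \<and> length cs = s + t + u \<and>
     sorted_wrt (<) as \<and> sorted_wrt (<) bs \<and> sorted_wrt (<) cs \<and>
     distinct (as @ bs @ cs) \<and>
     set (as @ bs @ cs) = {1..length as + length bs + length cs})"

definition bullied :: "nat \<Rightarrow> nat set \<Rightarrow> nat" where
  "bullied x A = (if \<exists>y\<in>A. x < y then Min {y \<in> A. x < y} else Min A)"

text \<open>
  In the next two functions the list holds the entries of one row in the order in which their
  paths reach it, and the set holds the available entries of the next row. Since the available
  entries of different rows do not interact, following the paths one at a time is the same as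
  treating all transitions between two consecutive rows before going on to the next row.
\<close>

fun bully_targets :: "nat list \<Rightarrow> nat set \<Rightarrow> nat list" where
  "bully_targets [] A = []"
| "bully_targets (x # xs) A = bullied x A # bully_targets xs (A - {bullied x A})"

fun num_wrappings :: "nat list \<Rightarrow> nat set \<Rightarrow> nat" where
  "num_wrappings [] A = 0"
| "num_wrappings (x # xs) A =
     (if \<exists>y\<in>A. x < y then 0 else 1) + num_wrappings xs (A - {bullied x A})"

text \<open>
  Paths starting in the same row are followed in increasing order of their starting entries.
\<close>

definition row2_first :: "nat list \<times> nat list \<times> nat list \<Rightarrow> nat list" where
  "row2_first = (\<lambda>(as, bs, cs). bully_targets as (set bs))"

definition row2_second :: "nat list \<times> nat list \<times> nat list \<Rightarrow> nat list" where
  "row2_second = (\<lambda>(as, bs, cs). filter (\<lambda>b. b \<notin> set (row2_first (as, bs, cs))) bs)"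

definition endpoints1 :: "nat list \<times> nat list \<times> nat list \<Rightarrow> nat set" where
  "endpoints1 = (\<lambda>(as, bs, cs). set (bully_targets (row2_first (as, bs, cs)) (set cs)))"

definition endpoints2 :: "nat list \<times> nat list \<times> nat list \<Rightarrow> nat set" where
  "endpoints2 = (\<lambda>(as, bs, cs).
     set (bully_targets (row2_second (as, bs, cs)) (set cs - endpoints1 (as, bs, cs))))"

definition wrappings23 :: "nat list \<times> nat list \<times> nat list \<Rightarrow> nat" where
  "wrappings23 = (\<lambda>(as, bs, cs).
     num_wrappings (row2_first (as, bs, cs)) (set cs) +
     num_wrappings (row2_second (as, bs, cs)) (set cs - endpoints1 (as, bs, cs)))"

definition projected_word :: "nat list \<times> nat list \<times> nat list \<Rightarrow> nat list" where
  "projected_word = (\<lambda>(as, bs, cs).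
     map (\<lambda>c. if c \<in> endpoints1 (as, bs, cs) then 1
              else if c \<in> endpoints2 (as, bs, cs) then 2 else 3) cs)"

text \<open>The word is indexed from 0, so its first two letters are at positions 0 and 1.\<close>

definition beta13 :: "nat \<Rightarrow> nat \<Rightarrow> nat \<Rightarrow> nat" where
  "beta13 s t n = card {(as, bs, cs).
     is_cmlq s t (n - s - t) (as, bs, cs) \<and>
     n + 2 * s + t \<in> set cs \<and>
     wrappings23 (as, bs, cs) = 1 \<and>
     projected_word (as, bs, cs) ! 0 = 1 \<and>
     projected_word (as, bs, cs) ! 1 = 3}"

text \<open>A tableau is the list of its rows; the shape is assumed to be a partition.\<close>

definition is_SYT :: "nat list \<Rightarrow> nat list list \<Rightarrow> bool" where
  "is_SYT sh T \<longleftrightarrow>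
     map length T = sh \<and>
     (\<forall>r\<in>set T. sorted_wrt (<) r) \<and>
     (\<forall>i j. Suc i < length T \<and> j < length (T ! Suc i) \<longrightarrow> T ! i ! j < T ! Suc i ! j) \<and>
     distinct (concat T) \<and> set (concat T) = {1..sum_list sh}"

definition num_SYT :: "nat list \<Rightarrow> nat" where
  "num_SYT sh = card {T. is_SYT sh T}"

definition binom :: "nat \<Rightarrow> int \<Rightarrow> nat" where
  "binom x k = (if k < 0 then 0 else x choose nat k)"

end

theory Submission
  imports Defs "HOL-Library.Infinite_Set"
begin

text \<open>
  The number of wrappings from row 2 to row 3 is the largest excess, over all \<open>z\<close>, of entries
  \<open>\<ge> z\<close> of row 2 over those of row 3. The condition on the word then says: two entries of row 3
  precede row 2, the largest excess is 1, and it is attained at some \<open>z\<close> from which on every entry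
  of row 2 is bullied from row 1. Deleting \<open>N\<close> raises the largest excess to 2. Take the last
  place \<open>p\<close> where it is attained and the last place \<open>a < p\<close> where row 2 is furthest ahead of row 1;
  then \<open>a\<close> is in row 1 and \<open>p\<close> in row 2. Moving \<open>a\<close> to row 2 and \<open>p\<close> to row 3 is a bijection
  (a product of two crystal operators) that lowers the largest excess and the length of row 1 by
  one. After two such moves row 1 is arbitrary, and the other two rows form two entries of row 3
  followed by a reversed ballot sequence, that is, by a standard tableau with two rows.
\<close>

section \<open>Comparing two sets on a range\<close>

definition surplus :: "'a set \<Rightarrow> 'a set \<Rightarrow> 'a set \<Rightarrow> int" where
  "surplus X Y S = int (card (X \<inter> S)) - int (card (Y \<inter> S))"

abbreviation lead :: "nat set \<Rightarrow> nat set \<Rightarrow> nat \<Rightarrow> int" where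
  "lead X Y z \<equiv> surplus X Y {..<z}"

abbreviation excess :: "nat set \<Rightarrow> nat set \<Rightarrow> nat \<Rightarrow> int" where
  "excess X Y z \<equiv> surplus X Y {z..}"

lemma surplus_swap: "surplus Y X S = - surplus X Y S"
  by (simp add: surplus_def)

lemma surplus_insert_left:
  assumes "finite X" "x \<notin> X"
  shows "surplus (insert x X) Y S = surplus X Y S + of_bool (x \<in> S)"
  using assms by (cases "x \<in> S") (simp_all add: surplus_def)

lemma surplus_insert_right:
  assumes "finite Y" "y \<notin> Y"
  shows "surplus X (insert y Y) S = surplus X Y S - of_bool (y \<in> S)"
  using assms by (cases "y \<in> S") (simp_all add: surplus_def)

lemma surplus_subset_right:
  assumes "finite Y" "T \<subseteq> Y"
  shows "surplus X Y S = surplus X T S - int (card ((Y - T) \<inter> S))"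
proof -
  have "card (Y \<inter> S) = card (Y \<inter> S \<inter> T) + card (Y \<inter> S - T)"
    using assms(1) by (intro card_Int_Diff) simp
  moreover have "Y \<inter> S \<inter> T = T \<inter> S" "Y \<inter> S - T = (Y - T) \<inter> S" using assms(2) by blast+
  ultimately have "card (Y \<inter> S) = card (T \<inter> S) + card ((Y - T) \<inter> S)" by (simp only:)
  then show ?thesis by (simp add: surplus_def)
qed

lemma lead_Suc: "lead X Y (Suc z) = lead X Y z + of_bool (z \<in> X) - of_bool (z \<in> Y)"
proof -
  have "card (Z \<inter> {..<Suc z}) = card (Z \<inter> {..<z}) + of_bool (z \<in> Z)" for Z
    by (simp add: lessThan_Suc Int_insert_right)
  then show ?thesis by (simp add: surplus_def)
qed

lemma excess_Suc:
  assumes "finite X" "finite Y"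
  shows "excess X Y z = excess X Y (Suc z) + of_bool (z \<in> X) - of_bool (z \<in> Y)"
proof -
  have "card (Z \<inter> {z..}) = card (Z \<inter> {Suc z..}) + of_bool (z \<in> Z)" if "finite Z" for Z
  proof -
    have "Z \<inter> {z..} = (if z \<in> Z then insert z (Z \<inter> {Suc z..}) else Z \<inter> {Suc z..})"
      by (auto simp: Suc_le_eq le_less)
    then show ?thesis using that by simp
  qed
  then show ?thesis using assms by (simp add: surplus_def)
qed

lemma lead_add_excess:
  assumes "finite X" "finite Y"
  shows "lead X Y z + excess X Y z = int (card X) - int (card Y)"
proof -
  have "card (Z \<inter> {..<z}) + card (Z \<inter> {z..}) = card Z" if "finite Z" for Z
  proof -
    have "Z - {..<z} = Z \<inter> {z..}" by auto
    then show ?thesis using card_Int_Diff[OF that, of "{..<z}"] by simp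
  qed
  then have "card (X \<inter> {..<z}) + card (X \<inter> {z..}) = card X"
    "card (Y \<inter> {..<z}) + card (Y \<inter> {z..}) = card Y" using assms by auto
  then show ?thesis unfolding surplus_def by linarith
qed

lemma excess_beyond:
  assumes "X \<subseteq> {..<z}" "Y \<subseteq> {..<z}"
  shows "excess X Y z = 0"
proof -
  have "X \<inter> {z..} = {}" "Y \<inter> {z..} = {}" using assms by force+
  then show ?thesis by (simp add: surplus_def)
qed

lemma lead_beyond:
  assumes "X \<subseteq> {..<z}" "Y \<subseteq> {..<z}"
  shows "lead X Y z = int (card X) - int (card Y)"
proof -
  have "X \<inter> {..<z} = X" "Y \<inter> {..<z} = Y" using assms by blast+
  then show ?thesis by (simp add: surplus_def)
qed

section \<open>Bully paths between two rows\<close>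

definition transition :: "nat list \<Rightarrow> nat set \<Rightarrow> bool" where
  "transition xs Y \<longleftrightarrow> finite Y \<and> distinct xs \<and> set xs \<inter> Y = {} \<and> length xs \<le> card Y"

lemma bullied_in:
  assumes "finite Y" "Y \<noteq> {}"
  shows "bullied x Y \<in> Y"
proof (cases "\<exists>y\<in>Y. x < y")
  case True
  then have "{y \<in> Y. x < y} \<noteq> {}" by blast
  then have "Min {y \<in> Y. x < y} \<in> {y \<in> Y. x < y}" using assms by (intro Min_in) auto
  then show ?thesis using True by (simp add: bullied_def)
qed (use assms in \<open>simp add: bullied_def\<close>)

lemma bullied_above:
  assumes "finite Y" "y \<in> Y" "x < y"
  shows "x < bullied x Y" "bullied x Y \<le> y"
proof -
  have "finite {y \<in> Y. x < y}" "y \<in> {y \<in> Y. x < y}" using assms by auto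
  then have "Min {y \<in> Y. x < y} \<in> {y \<in> Y. x < y}" "Min {y \<in> Y. x < y} \<le> y"
    using Min_in Min_le by blast+
  moreover have "bullied x Y = Min {y \<in> Y. x < y}" using assms by (auto simp: bullied_def)
  ultimately show "x < bullied x Y" "bullied x Y \<le> y" by simp_all
qed

lemma bullied_wrap:
  assumes "finite Y" "y \<in> Y" "\<not> (\<exists>y\<in>Y. x < y)"
  shows "bullied x Y \<le> y"
  using assms by (simp add: bullied_def)

lemma transition_ConsD:
  assumes "transition (x # xs) Y"
  shows "bullied x Y \<in> Y" "transition xs (Y - {bullied x Y})"
proof -
  show "bullied x Y \<in> Y" using assms by (intro bullied_in) (auto simp: transition_def)
  then show "transition xs (Y - {bullied x Y})" using assms by (auto simp: transition_def)
qed

lemma transition_appendD: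
  assumes "transition (xs @ ys) Y"
  shows "transition xs Y"
  using assms by (auto simp: transition_def)

lemma length_bully_targets [simp]: "length (bully_targets xs Y) = length xs"
  by (induction xs Y rule: bully_targets.induct) simp_all

lemma bully_targets_transition:
  assumes "transition xs Y"
  shows "set (bully_targets xs Y) \<subseteq> Y" "distinct (bully_targets xs Y)"
proof -
  have "set (bully_targets xs Y) \<subseteq> Y \<and> distinct (bully_targets xs Y)"
    using assms
  proof (induction xs arbitrary: Y)
    case (Cons x xs)
    note ConsD = transition_ConsD[OF Cons.prems]
    then show ?case using Cons.IH[OF ConsD(2)] by auto
  qed simp
  then show "set (bully_targets xs Y) \<subseteq> Y" "distinct (bully_targets xs Y)" by simp_all
qed

lemma bully_targets_append:
  "bully_targets (xs @ ys) Y = bully_targets xs Y @ bully_targets ys (Y - set (bully_targets xs Y))"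
  by (induction xs arbitrary: Y) (simp_all add: Diff_insert[symmetric] Diff_insert2[symmetric])

lemma num_wrappings_append:
  "num_wrappings (xs @ ys) Y = num_wrappings xs Y + num_wrappings ys (Y - set (bully_targets xs Y))"
  by (induction xs arbitrary: Y) (simp_all add: Diff_insert[symmetric] Diff_insert2[symmetric])

lemma lead_bully_targets_Cons:
  assumes "transition (x # xs) Y"
  shows "lead (set (bully_targets (x # xs) Y)) (set (x # xs)) z =
    lead (set (bully_targets xs (Y - {bullied x Y}))) (set xs) z
      + of_bool (bullied x Y < z) - of_bool (x < z)"
proof -
  have "bullied x Y \<notin> set (bully_targets xs (Y - {bullied x Y}))"
    using bully_targets_transition(1)[OF transition_ConsD(2)[OF assms]] by blast
  moreover have "x \<notin> set xs" using assms by (simp add: transition_def)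
  ultimately show ?thesis by (simp add: surplus_insert_left surplus_insert_right)
qed

lemma lead_bully_targets_le:
  assumes "transition xs Y"
  shows "lead (set (bully_targets xs Y)) (set xs) z \<le> int (num_wrappings xs Y)"
  using assms
proof (induction xs arbitrary: Y)
  case (Cons x xs)
  have "finite Y" using Cons.prems by (simp add: transition_def)
  then have "x < bullied x Y" if "\<exists>y\<in>Y. x < y" using bullied_above(1) that by blast
  then have "bullied x Y < z \<longrightarrow> \<not> x < z \<longrightarrow> \<not> (\<exists>y\<in>Y. x < y)"
    using less_trans by blast
  then show ?case
    using Cons.IH[OF transition_ConsD(2)[OF Cons.prems]]
      lead_bully_targets_Cons[OF Cons.prems, of z] by auto
qed (simp add: surplus_def)

text \<open>An entry that stays available is never jumped over, except by the paths that wrap.\<close>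

lemma lead_bully_targets_unbullied:
  assumes "transition xs Y" "b \<in> Y" "b \<notin> set (bully_targets xs Y)"
  shows "lead (set (bully_targets xs Y)) (set xs) b = int (num_wrappings xs Y)"
  using assms
proof (induction xs arbitrary: Y)
  case (Cons x xs)
  note b = Cons.prems(2,3)
  have fin: "finite Y" and neq: "b \<noteq> bullied x Y" "b \<noteq> x"
    using Cons.prems by (auto simp: transition_def)
  have "of_bool (bullied x Y < b) - of_bool (x < b) = (if \<exists>y\<in>Y. x < y then 0 else 1 :: int)"
  proof (cases "\<exists>y\<in>Y. x < y")
    case True
    then have "x < bullied x Y" using bullied_above(1)[OF fin] by blast
    then show ?thesis using True bullied_above(2)[OF fin b(1), of x] neq by auto
  next
    case False
    then show ?thesis using bullied_wrap[OF fin b(1) False] b(1) neq by auto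
  qed
  moreover have "lead (set (bully_targets xs (Y - {bullied x Y}))) (set xs) b =
      int (num_wrappings xs (Y - {bullied x Y}))"
    using Cons.IH[OF transition_ConsD(2)[OF Cons.prems(1)]] b neq by simp
  ultimately show ?case using lead_bully_targets_Cons[OF Cons.prems(1), of b] by simp
qed (simp add: surplus_def)

lemma lead_bully_targets_Suc_unbullied:
  assumes "transition xs Y" "b \<in> Y" "b \<notin> set (bully_targets xs Y)"
  shows "lead (set (bully_targets xs Y)) (set xs) (Suc b) = int (num_wrappings xs Y)"
proof -
  have "b \<notin> set xs" using assms(1,2) by (auto simp: transition_def)
  then show ?thesis
    using lead_bully_targets_unbullied[OF assms] assms(3) by (simp add: lead_Suc)
qed

lemma last_unbullied:
  assumes "transition xs Y" "length xs < card Y"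
  obtains b where "b \<in> Y" "b \<notin> set (bully_targets xs Y)"
    "\<And>y. y \<in> Y \<Longrightarrow> b < y \<Longrightarrow> y \<in> set (bully_targets xs Y)"
proof -
  define V where "V = Y - set (bully_targets xs Y)"
  have "card (set (bully_targets xs Y)) < card Y"
    using assms(2) bully_targets_transition(2)[OF assms(1)] by (simp add: distinct_card)
  then have "V \<noteq> {}" using card_mono[of "set (bully_targets xs Y)" Y] by (auto simp: V_def)
  moreover have "finite V" using assms(1) by (simp add: transition_def V_def)
  ultimately have "Max V \<in> V" "\<And>y. y \<in> V \<Longrightarrow> y \<le> Max V" by simp_all
  then show thesis using that[of "Max V"] unfolding V_def by (metis Diff_iff not_le)
qed

lemma excess_bully_targets:
  assumes "transition xs Y"
  shows "excess (set xs) (set (bully_targets xs Y)) z = lead (set (bully_targets xs Y)) (set xs) z"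
proof -
  have "card (set (bully_targets xs Y)) = card (set xs)"
    using assms bully_targets_transition(2)[OF assms] by (simp add: transition_def distinct_card)
  then show ?thesis
    using lead_add_excess[of "set xs" "set (bully_targets xs Y)" z] surplus_swap[of "set xs"]
    by simp
qed

lemma excess_le_num_wrappings:
  assumes "transition xs Y"
  shows "excess (set xs) Y z \<le> int (num_wrappings xs Y)"
proof -
  have "finite Y" using assms by (simp add: transition_def)
  then have "excess (set xs) Y z \<le> excess (set xs) (set (bully_targets xs Y)) z"
    using surplus_subset_right[OF _ bully_targets_transition(1)[OF assms]] by simp
  then show ?thesis
    using excess_bully_targets[OF assms, of z] lead_bully_targets_le[OF assms, of z] by simp
qed

lemma excess_above_last_unbullied:
  assumes "transition xs Y" "b \<in> Y" "b \<notin> set (bully_targets xs Y)"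
    and last: "\<And>y. y \<in> Y \<Longrightarrow> b < y \<Longrightarrow> y \<in> set (bully_targets xs Y)"
  shows "excess (set xs) Y (Suc b) = int (num_wrappings xs Y)"
proof -
  have "finite Y" using assms(1) by (simp add: transition_def)
  moreover have "(Y - set (bully_targets xs Y)) \<inter> {Suc b..} = {}" using last by auto
  ultimately have "excess (set xs) Y (Suc b) = excess (set xs) (set (bully_targets xs Y)) (Suc b)"
    using surplus_subset_right[OF _ bully_targets_transition(1)[OF assms(1)]] by simp
  then show ?thesis
    using excess_bully_targets[OF assms(1)] lead_bully_targets_Suc_unbullied[OF assms(1-3)] by simp
qed

text \<open>
  The place is just above the last entry that is available at the moment of the last wrapping.
\<close>

lemma num_wrappings_attained:
  assumes "transition xs Y" "num_wrappings xs Y > 0"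
  shows "\<exists>z. int (num_wrappings xs Y) \<le> excess (set xs) Y z"
  using assms
proof (induction xs rule: rev_induct)
  case (snoc x xs)
  define V where "V = Y - set (bully_targets xs Y)"
  have tr: "transition xs Y" using snoc.prems(1) by (rule transition_appendD)
  have x: "x \<notin> set xs" "x \<notin> Y" using snoc.prems(1) by (auto simp: transition_def)
  have excess: "excess (set (xs @ [x])) Y z = excess (set xs) Y z + of_bool (z \<le> x)" for z
    using x by (simp add: surplus_insert_left)
  have wrappings: "num_wrappings (xs @ [x]) Y = num_wrappings xs Y + of_bool (\<not> (\<exists>y\<in>V. x < y))"
    by (simp add: num_wrappings_append V_def)
  show ?case
  proof (cases "\<exists>y\<in>V. x < y")
    case True
    then obtain z where "int (num_wrappings xs Y) \<le> excess (set xs) Y z"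
      using snoc.IH[OF tr] snoc.prems(2) wrappings by auto
    then have "int (num_wrappings (xs @ [x]) Y) \<le> excess (set (xs @ [x])) Y z"
      using True wrappings excess[of z] by simp
    then show ?thesis by blast
  next
    case False
    have "length xs < card Y" using snoc.prems(1) by (simp add: transition_def)
    then obtain b where b: "b \<in> Y" "b \<notin> set (bully_targets xs Y)"
      "\<And>y. y \<in> Y \<Longrightarrow> b < y \<Longrightarrow> y \<in> set (bully_targets xs Y)"
      using last_unbullied[OF tr] by blast
    have "excess (set xs) Y (Suc b) = int (num_wrappings xs Y)"
      using b by (rule excess_above_last_unbullied[OF tr])
    moreover have "b < x" using False b(1,2) x(2) by (metis DiffI V_def linorder_neqE_nat)
    ultimately have "excess (set (xs @ [x])) Y (Suc b) = int (num_wrappings (xs @ [x]) Y)"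
      using False wrappings excess[of "Suc b"] by simp
    then show ?thesis by (metis order_refl)
  qed
qed simp

lemma num_wrappings_le_iff:
  assumes "transition xs Y"
  shows "num_wrappings xs Y \<le> k \<longleftrightarrow> (\<forall>z. excess (set xs) Y z \<le> int k)"
proof
  assume "num_wrappings xs Y \<le> k"
  then show "\<forall>z. excess (set xs) Y z \<le> int k"
    using excess_le_num_wrappings[OF assms] by (meson order_trans of_nat_le_iff)
next
  assume bound: "\<forall>z. excess (set xs) Y z \<le> int k"
  show "num_wrappings xs Y \<le> k"
  proof (cases "num_wrappings xs Y = 0")
    case False
    then obtain z where "int (num_wrappings xs Y) \<le> excess (set xs) Y z"
      using num_wrappings_attained[OF assms] by auto
    then show ?thesis using bound by (meson order_trans of_nat_le_iff)
  qed simp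
qed

lemma num_wrappings_prefix_iff:
  assumes tr: "transition (xs @ ys) Y" and "k > 0"
  defines "X \<equiv> set (xs @ ys)"
  shows "num_wrappings (xs @ ys) Y = k \<and> num_wrappings xs Y = k \<longleftrightarrow>
    (\<forall>z. excess X Y z \<le> int k) \<and> (\<exists>z. excess X Y z = int k \<and> X \<inter> {z..} \<subseteq> set xs)"
proof -
  note trxs = transition_appendD[OF tr]
  show ?thesis
  proof
    assume wrappings: "num_wrappings (xs @ ys) Y = k \<and> num_wrappings xs Y = k"
    then have bound: "\<forall>z. excess X Y z \<le> int k"
      using num_wrappings_le_iff[OF tr, of k] by (simp add: X_def)
    obtain z where z: "int k \<le> excess (set xs) Y z"
      using num_wrappings_attained[OF trxs] wrappings \<open>k > 0\<close> by auto
    have sub: "set xs \<inter> {z..} \<subseteq> X \<inter> {z..}" and fin: "finite (X \<inter> {z..})" by (auto simp: X_def)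
    then have "card (set xs \<inter> {z..}) \<le> card (X \<inter> {z..})" by (intro card_mono)
    then have peak: "excess X Y z = int k" and "card (X \<inter> {z..}) \<le> card (set xs \<inter> {z..})"
      using z bound[rule_format, of z] unfolding surplus_def by linarith+
    then have "set xs \<inter> {z..} = X \<inter> {z..}" using sub fin by (intro card_seteq)
    then show "(\<forall>z. excess X Y z \<le> int k) \<and> (\<exists>z. excess X Y z = int k \<and> X \<inter> {z..} \<subseteq> set xs)"
      using bound peak by blast
  next
    assume "(\<forall>z. excess X Y z \<le> int k) \<and> (\<exists>z. excess X Y z = int k \<and> X \<inter> {z..} \<subseteq> set xs)"
    then obtain z where bound: "\<forall>z. excess X Y z \<le> int k"
      and z: "excess X Y z = int k" "X \<inter> {z..} \<subseteq> set xs" by blast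
    have "X \<inter> {z..} = set xs \<inter> {z..}" using z(2) by (auto simp: X_def)
    then have "excess (set xs) Y z = int k" using z(1) by (simp add: surplus_def)
    then have "k \<le> num_wrappings xs Y" using excess_le_num_wrappings[OF trxs, of z] by simp
    moreover have "num_wrappings xs Y \<le> num_wrappings (xs @ ys) Y"
      by (simp add: num_wrappings_append)
    moreover have "num_wrappings (xs @ ys) Y \<le> k"
      using num_wrappings_le_iff[OF tr] bound by (simp add: X_def)
    ultimately show "num_wrappings (xs @ ys) Y = k \<and> num_wrappings xs Y = k" by simp
  qed
qed

text \<open>
  If \<^term>\<open>A\<close> has fewer elements than \<^term>\<open>B\<close>, this says that every element of \<^term>\<open>B\<close> from
  \<^term>\<open>z\<close> on is bullied from \<^term>\<open>A\<close>.
\<close>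

definition covered :: "nat set \<Rightarrow> nat set \<Rightarrow> nat \<Rightarrow> bool" where
  "covered A B z \<longleftrightarrow> (\<exists>u\<le>z. \<forall>v\<ge>z. lead A B u \<le> lead A B v)"

lemma unbullied_not_covered:
  assumes tr: "transition xs Y" and b: "b \<in> Y" "b \<notin> set (bully_targets xs Y)" "z \<le> b"
  shows "\<not> covered (set xs) Y z"
proof
  let ?T = "set (bully_targets xs Y)"
  have fin: "finite Y" using tr by (simp add: transition_def)
  note split = surplus_subset_right[OF fin bully_targets_transition(1)[OF tr]]
  assume "covered (set xs) Y z"
  then obtain u where u: "u \<le> z" "lead (set xs) Y u \<le> lead (set xs) Y (Suc b)"
    using b(3) unfolding covered_def by (meson le_SucI)
  have "(Y - ?T) \<inter> {..<u} \<subseteq> (Y - ?T) \<inter> {..<Suc b}" using b(3) u(1) by auto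
  moreover have "b \<in> (Y - ?T) \<inter> {..<Suc b}" "b \<notin> (Y - ?T) \<inter> {..<u}" using b u(1) by auto
  ultimately have "card ((Y - ?T) \<inter> {..<u}) < card ((Y - ?T) \<inter> {..<Suc b})"
    by (intro psubset_card_mono) blast+
  moreover have "lead (set xs) ?T (Suc b) \<le> lead (set xs) ?T u"
    using lead_bully_targets_Suc_unbullied[OF tr b(1,2)] lead_bully_targets_le[OF tr, of u]
      surplus_swap[of ?T] by simp
  ultimately show False using u(2) split by simp
qed

lemma covered_above_unbullied:
  assumes tr: "transition xs Y" and less: "length xs < card Y"
    and sub: "Y \<inter> {z..} \<subseteq> set (bully_targets xs Y)"
  shows "covered (set xs) Y z"
proof -
  let ?T = "set (bully_targets xs Y)"
  obtain b where b: "b \<in> Y" "b \<notin> ?T" "\<And>y. y \<in> Y \<Longrightarrow> b < y \<Longrightarrow> y \<in> ?T"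
    using last_unbullied[OF tr less] by blast
  have fin: "finite Y" using tr by (simp add: transition_def)
  have "b < z" using b(1,2) sub by force
  have "lead (set xs) Y (Suc b) \<le> lead (set xs) Y v" if "v \<ge> Suc b" for v
  proof -
    have "(Y - ?T) \<inter> {..<v} = (Y - ?T) \<inter> {..<Suc b}" using b(3) that by fastforce
    moreover have "lead (set xs) ?T (Suc b) \<le> lead (set xs) ?T v"
      using lead_bully_targets_Suc_unbullied[OF tr b(1,2)] lead_bully_targets_le[OF tr, of v]
        surplus_swap[of ?T] by simp
    ultimately show ?thesis
      using surplus_subset_right[OF fin bully_targets_transition(1)[OF tr]] by simp
  qed
  then show ?thesis unfolding covered_def using \<open>b < z\<close> by (meson Suc_leI order_trans)
qed

lemma bully_targets_cover_iff:
  assumes "transition xs Y" "length xs < card Y"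
  shows "Y \<inter> {z..} \<subseteq> set (bully_targets xs Y) \<longleftrightarrow> covered (set xs) Y z"
  using covered_above_unbullied[OF assms] unbullied_not_covered[OF assms(1)] by fastforce

lemma card_below_second_unbullied:
  assumes tr: "transition xs Y" and c: "Y \<inter> {..c2} = {c1, c2}" "c1 < c2"
    and free: "c2 \<notin> set (bully_targets xs Y)"
  shows "of_bool (c1 \<in> set (bully_targets xs Y)) = card (set xs \<inter> {..<c2}) + num_wrappings xs Y"
proof -
  let ?T = "set (bully_targets xs Y)"
  have "Y \<inter> {..<c2} = Y \<inter> {..c2} - {c2}" by auto
  also have "\<dots> = {c1}" using c by auto
  finally have "?T \<inter> {..<c2} = (if c1 \<in> ?T then {c1} else {})"
    using bully_targets_transition(1)[OF tr] by auto
  then have "card (?T \<inter> {..<c2}) = of_bool (c1 \<in> ?T)" by simp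
  moreover have "c2 \<in> Y" using c(1) by blast
  then have "lead ?T (set xs) c2 = int (num_wrappings xs Y)"
    using free by (rule lead_bully_targets_unbullied[OF tr])
  ultimately show ?thesis unfolding surplus_def by linarith
qed

lemma second_unbullied:
  assumes tr: "transition xs Y" and c: "Y \<inter> {..c2} = {c1, c2}" "c1 < c2"
    and above: "\<forall>x\<in>set xs. c2 < x" and wrap: "num_wrappings xs Y = 1"
  shows "c2 \<notin> set (bully_targets xs Y)"
proof
  let ?T = "set (bully_targets xs Y)"
  assume "c2 \<in> ?T"
  have below: "set xs \<inter> {..<z} = {}" if "z \<le> Suc c2" for z using above that by fastforce
  have "card (?T \<inter> {..<Suc c2}) \<le> 1"
    using lead_bully_targets_le[OF tr, of "Suc c2"] wrap below[of "Suc c2"]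
    by (simp add: surplus_def)
  moreover have "c1 \<in> ?T \<Longrightarrow> {c1, c2} \<subseteq> ?T \<inter> {..<Suc c2}" using \<open>c2 \<in> ?T\<close> c(2) by auto
  then have "c1 \<in> ?T \<Longrightarrow> card {c1, c2} \<le> card (?T \<inter> {..<Suc c2})" by (intro card_mono) auto
  ultimately have "c1 \<notin> ?T" using c(2) by auto
  moreover have "c1 \<in> Y" using c(1) by blast
  ultimately have "lead ?T (set xs) c1 = 1" using lead_bully_targets_unbullied[OF tr] wrap by simp
  moreover have "?T \<inter> {..<c1} = {}"
  proof -
    have "Y \<inter> {..<c1} = (Y \<inter> {..c2}) \<inter> {..<c1}" using c(2) by auto
    also have "\<dots> = {}" unfolding c(1) using c(2) by auto
    finally show ?thesis using bully_targets_transition(1)[OF tr] by blast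
  qed
  ultimately show False by (simp add: surplus_def)
qed

lemma first_letters_iff:
  assumes tr: "transition (xs @ ys) Y" and c: "Y \<inter> {..c2} = {c1, c2}" "c1 < c2"
    and wrap: "num_wrappings (xs @ ys) Y = 1"
  shows "c1 \<in> set (bully_targets xs Y) \<and> c2 \<notin> set (bully_targets (xs @ ys) Y) \<longleftrightarrow>
    num_wrappings xs Y = 1 \<and> (\<forall>x\<in>set (xs @ ys). c2 < x)"
    (is "?letters \<longleftrightarrow> ?wrap \<and> ?above")
proof -
  note trxs = transition_appendD[OF tr]
  have c2: "c2 \<notin> set (xs @ ys)" using tr c(1) by (auto simp: transition_def)
  show ?thesis
  proof
    assume ?letters
    then have free: "c2 \<notin> set (bully_targets (xs @ ys) Y)" "c2 \<notin> set (bully_targets xs Y)"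
      and c1: "c1 \<in> set (bully_targets xs Y)" by (auto simp: bully_targets_append)
    have "card (set (xs @ ys) \<inter> {..<c2}) = 0"
      using card_below_second_unbullied[OF tr c free(1)] wrap
      by (simp add: of_bool_def split: if_splits)
    then have below: "set (xs @ ys) \<inter> {..<c2} = {}" by simp
    then have "set xs \<inter> {..<c2} = {}" by auto
    then have ?wrap using card_below_second_unbullied[OF trxs c free(2)] c1 by simp
    moreover have ?above using below c2 by (metis disjoint_iff lessThan_iff linorder_neqE_nat)
    ultimately show "?wrap \<and> ?above" by simp
  next
    assume wrap_above: "?wrap \<and> ?above"
    then have free: "c2 \<notin> set (bully_targets (xs @ ys) Y)"
      using second_unbullied[OF tr c] wrap wrap_above by blast
    then have "c2 \<notin> set (bully_targets xs Y)" by (simp add: bully_targets_append)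
    then have "c1 \<in> set (bully_targets xs Y)"
      using card_below_second_unbullied[OF trxs c] wrap_above
      by (simp add: of_bool_def split: if_splits)
    then show ?letters using free by simp
  qed
qed

section \<open>Pivots\<close>

definition covered_peak :: "int \<Rightarrow> nat set \<Rightarrow> nat set \<Rightarrow> nat set \<Rightarrow> bool" where
  "covered_peak k A B C \<longleftrightarrow>
     (\<forall>z. excess B C z \<le> k) \<and> (\<exists>z. excess B C z = k \<and> covered A B z)"

text \<open>
  Inserting \<open>a\<close> into \<open>A\<close> and \<open>p\<close> into \<open>B\<close> raises the largest excess to \<open>k + 1\<close> and makes \<open>a\<close>
  and \<open>p\<close> the last places where the extrema are attained. Inserting \<open>a\<close> into \<open>B\<close> and \<open>p\<close> into
  \<open>C\<close> keeps it at \<open>k\<close> and makes the places just after \<open>a\<close> and \<open>p\<close> the first ones.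
\<close>

definition pivot :: "int \<Rightarrow> nat set \<Rightarrow> nat set \<Rightarrow> nat set \<Rightarrow> nat \<Rightarrow> nat \<Rightarrow> bool" where
  "pivot k A B C a p \<longleftrightarrow> a < p \<and> excess B C p = k \<and> (\<forall>z. excess B C z \<le> k) \<and>
     (\<forall>v. lead A B a \<le> lead A B v)"

definition last_pivot :: "int \<Rightarrow> nat set \<Rightarrow> nat set \<Rightarrow> nat set \<Rightarrow> nat \<Rightarrow> nat \<Rightarrow> bool" where
  "last_pivot k A B C a p \<longleftrightarrow> pivot k A B C a p \<and> (\<forall>z>p. excess B C z < k) \<and>
     (\<forall>v. a < v \<and> v \<le> p \<longrightarrow> lead A B a < lead A B v)"

definition first_pivot :: "int \<Rightarrow> nat set \<Rightarrow> nat set \<Rightarrow> nat set \<Rightarrow> nat \<Rightarrow> nat \<Rightarrow> bool" where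
  "first_pivot k A B C a p \<longleftrightarrow> pivot k A B C (Suc a) (Suc p) \<and>
     (\<forall>z. a < z \<and> z \<le> p \<longrightarrow> excess B C z < k) \<and> (\<forall>v\<le>a. lead A B (Suc a) < lead A B v)"

lemma covered_peak_if_pivot:
  assumes "pivot k A B C a p"
  shows "covered_peak k A B C"
proof -
  have "a \<le> p" "excess B C p = k" "\<forall>z. excess B C z \<le> k" "\<forall>v. lead A B a \<le> lead A B v"
    using assms by (simp_all add: pivot_def)
  then show ?thesis unfolding covered_peak_def covered_def by blast
qed

lemma last_pivot_unique:
  assumes "last_pivot k A B C a p" "last_pivot k A B C a' p'"
  shows "a = a' \<and> p = p'"
proof -
  have "p = p'"
    using assms unfolding last_pivot_def pivot_def by (metis less_irrefl nat_neq_iff)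
  moreover have "a = a'"
    using assms \<open>p = p'\<close> unfolding last_pivot_def pivot_def
    by (metis less_imp_le_nat not_le nat_neq_iff)
  ultimately show ?thesis by simp
qed

lemma first_pivot_unique:
  assumes "first_pivot k A B C a p" "first_pivot k A B C a' p'"
  shows "a = a' \<and> p = p'"
proof -
  have "a = a'"
    using assms unfolding first_pivot_def pivot_def by (metis Suc_leI not_le nat_neq_iff)
  moreover have "\<not> p < p'" "\<not> p' < p"
    using assms \<open>a = a'\<close> unfolding first_pivot_def pivot_def
    by (metis Suc_leI Suc_lessD less_irrefl)+
  ultimately show ?thesis by simp
qed

lemma last_pivot_mem:
  assumes "finite B" "finite C" "last_pivot k A B C a p"
  shows "a \<in> A" "p \<in> B"
proof -
  have "a < p" "lead A B a < lead A B (Suc a)"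
    using assms(3) unfolding last_pivot_def pivot_def by simp_all
  then show "a \<in> A" by (simp add: lead_Suc of_bool_def split: if_splits)
  have "excess B C (Suc p) < excess B C p"
    using assms(3) unfolding last_pivot_def pivot_def by simp
  then show "p \<in> B"
    using excess_Suc[OF assms(1,2), of p] by (simp add: of_bool_def split: if_splits)
qed

lemma first_pivot_mem:
  assumes "finite B" "finite C" "first_pivot k A B C a p"
  shows "a \<in> B" "p \<in> C"
proof -
  have "lead A B (Suc a) < lead A B a"
    using assms(3) unfolding first_pivot_def by simp
  then show "a \<in> B" by (simp add: lead_Suc of_bool_def split: if_splits)
  have "excess B C p < excess B C (Suc p)"
    using assms(3) unfolding first_pivot_def pivot_def by simp
  then show "p \<in> C"
    using excess_Suc[OF assms(1,2), of p] by (simp add: of_bool_def split: if_splits)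
qed

lemma last_pivot_insert_iff:
  assumes "finite A" "finite B" and "a \<notin> A" "p \<notin> B"
  shows "last_pivot (k + 1) (insert a A) (insert p B) C a p \<longleftrightarrow> pivot k A B C a p"
proof -
  have excess: "excess (insert p B) C z = excess B C z + of_bool (z \<le> p)" for z
    using assms by (simp add: surplus_insert_left)
  have lead: "lead (insert a A) (insert p B) v =
      lead A B v + of_bool (a < v) - of_bool (p < v)" for v
    using assms by (simp add: surplus_insert_left surplus_insert_right)
  show ?thesis
  proof
    assume last: "last_pivot (k + 1) (insert a A) (insert p B) C a p"
    then have "a < p" by (simp add: last_pivot_def pivot_def)
    have "excess B C z \<le> k" for z
      using last excess[of z] unfolding last_pivot_def pivot_def
      by (cases "z \<le> p") (auto dest!: spec[of _ z])
    moreover have "lead A B a \<le> lead A B v" for v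
      using last lead[of v] lead[of a] \<open>a < p\<close> unfolding last_pivot_def pivot_def
      by (cases "v \<le> a"; cases "v \<le> p") (auto dest!: spec[of _ v])
    ultimately show "pivot k A B C a p"
      using last excess[of p] \<open>a < p\<close> by (simp add: last_pivot_def pivot_def)
  next
    assume "pivot k A B C a p"
    then have "a < p" "excess B C p = k" "\<And>z. excess B C z \<le> k" "\<And>z. excess B C z < k + 1"
      "\<And>v. lead A B a \<le> lead A B v" "\<And>v. lead A B a < lead A B v + 1"
      by (simp_all add: pivot_def zless_add1_eq order_le_less)
    then show "last_pivot (k + 1) (insert a A) (insert p B) C a p"
      by (simp add: last_pivot_def pivot_def excess lead less_imp_le)
  qed
qed

lemma first_pivot_insert_iff:
  assumes fin: "finite B" "finite C" and new: "a \<notin> A" "a \<notin> B" "p \<notin> B" "p \<notin> C"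
  shows "first_pivot k A (insert a B) (insert p C) a p \<longleftrightarrow> pivot k A B C a p"
proof -
  have excess: "excess (insert a B) (insert p C) z =
      excess B C z + of_bool (z \<le> a) - of_bool (z \<le> p)" for z
    using assms by (simp add: surplus_insert_left surplus_insert_right)
  have lead: "lead A (insert a B) v = lead A B v - of_bool (a < v)" for v
    using assms by (simp add: surplus_insert_right)
  have Suc: "lead A B (Suc a) = lead A B a" "excess B C (Suc p) = excess B C p"
    using new excess_Suc[OF fin, of p] by (simp_all add: lead_Suc)
  show ?thesis
  proof
    assume first: "first_pivot k A (insert a B) (insert p C) a p"
    then have "a < p" by (simp add: first_pivot_def pivot_def)
    have "excess B C z \<le> k" for z
      using first excess[of z] \<open>a < p\<close> unfolding first_pivot_def pivot_def
      by (cases "z \<le> a"; cases "z \<le> p") (auto dest!: spec[of _ z])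
    moreover have "lead A B a \<le> lead A B v" for v
      using first lead[of v] lead[of "Suc a"] Suc(1) unfolding first_pivot_def pivot_def
      by (cases "v \<le> a") (auto dest!: spec[of _ v])
    ultimately show "pivot k A B C a p"
      using first excess[of "Suc p"] Suc(2) \<open>a < p\<close> by (simp add: first_pivot_def pivot_def)
  next
    assume "pivot k A B C a p"
    then have "a < p" "excess B C p = k" "\<And>z. excess B C z \<le> k" "\<And>z. excess B C z - 1 < k"
      "\<And>v. lead A B a \<le> lead A B v" "\<And>v. lead A B a - 1 < lead A B v"
      by (simp_all add: pivot_def diff_less_eq zless_add1_eq order_le_less)
    then show "first_pivot k A (insert a B) (insert p C) a p"
      using Suc by (simp add: first_pivot_def pivot_def excess lead less_imp_le)
  qed
qed

lemma last_argmin: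
  fixes f :: "nat \<Rightarrow> 'a :: linorder"
  obtains a where "a \<le> p" "\<And>v. v \<le> p \<Longrightarrow> f a \<le> f v" "\<And>v. a < v \<Longrightarrow> v \<le> p \<Longrightarrow> f a < f v"
proof -
  have "\<exists>a\<le>p. (\<forall>v\<le>p. f a \<le> f v) \<and> (\<forall>v. a < v \<and> v \<le> p \<longrightarrow> f a < f v)"
  proof (induction p)
    case (Suc p)
    then obtain a where a: "a \<le> p" "\<forall>v\<le>p. f a \<le> f v" "\<forall>v. a < v \<and> v \<le> p \<longrightarrow> f a < f v" by blast
    show ?case
    proof (cases "f a < f (Suc p)")
      case True
      then show ?thesis using a by (intro exI[of _ a]) (auto simp: le_Suc_eq)
    next
      case False
      then show ?thesis using a by (intro exI[of _ "Suc p"]) (fastforce simp: le_Suc_eq)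
    qed
  qed simp
  then show thesis using that by blast
qed

lemma first_argmin:
  fixes f :: "nat \<Rightarrow> 'a :: linorder"
  obtains q where "q \<le> z" "\<And>v. v \<le> z \<Longrightarrow> f q \<le> f v" "\<And>v. v < q \<Longrightarrow> f q < f v"
proof -
  have "\<exists>q\<le>z. (\<forall>v\<le>z. f q \<le> f v) \<and> (\<forall>v<q. f q < f v)"
  proof (induction z)
    case (Suc z)
    then obtain q where q: "q \<le> z" "\<forall>v\<le>z. f q \<le> f v" "\<forall>v<q. f q < f v" by blast
    show ?case
    proof (cases "f q \<le> f (Suc z)")
      case True
      then show ?thesis using q by (intro exI[of _ q]) (auto simp: le_Suc_eq)
    next
      case False
      then show ?thesis
        using q by (intro exI[of _ "Suc z"]) (fastforce simp: le_Suc_eq less_Suc_eq_le)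
    qed
  qed simp
  then show thesis using that by blast
qed

lemma covered_argmin:
  assumes "covered A B z" "z \<le> p" "\<And>v. v \<le> p \<Longrightarrow> lead A B a \<le> lead A B v"
  shows "lead A B a \<le> lead A B v"
proof (cases "v \<le> p")
  case False
  obtain u where "u \<le> z" "\<forall>v\<ge>z. lead A B u \<le> lead A B v"
    using assms(1) unfolding covered_def by blast
  then show ?thesis using assms(2) assms(3)[of u] False
    by (meson le_trans nat_le_linear order_trans)
qed (use assms(3) in simp)

lemma covered_last_argmin:
  assumes "covered A B z" "z \<le> p"
  obtains a where "a \<le> p" "\<And>v. lead A B a \<le> lead A B v"
    "\<And>v. a < v \<Longrightarrow> v \<le> p \<Longrightarrow> lead A B a < lead A B v"
proof -
  obtain a where a: "a \<le> p" "\<And>v. v \<le> p \<Longrightarrow> lead A B a \<le> lead A B v"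
    "\<And>v. a < v \<Longrightarrow> v \<le> p \<Longrightarrow> lead A B a < lead A B v"
    using last_argmin[of p "lead A B"] by blast
  then show thesis using that covered_argmin[OF assms a(2)] by blast
qed

lemma covered_first_argmin:
  assumes "covered A B z" "finite A" "finite B" "card A < card B"
  obtains a where "a < z" "\<And>v. lead A B (Suc a) \<le> lead A B v"
    "\<And>v. v \<le> a \<Longrightarrow> lead A B (Suc a) < lead A B v"
proof -
  obtain q where q: "q \<le> z" "\<And>v. v \<le> z \<Longrightarrow> lead A B q \<le> lead A B v"
    "\<And>v. v < q \<Longrightarrow> lead A B q < lead A B v"
    using first_argmin[of z "lead A B"] by blast
  have min: "lead A B q \<le> lead A B v" for v
    using covered_argmin[OF assms(1) order_refl q(2)] by blast
  obtain l where l: "A \<subseteq> {..<l}" "B \<subseteq> {..<l}"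
    using assms(2,3) finite_nat_iff_bounded[of "A \<union> B"] by auto
  have "lead A B q < 0" using min[of l] lead_beyond[OF l] assms(4) by simp
  then have "q \<noteq> 0" by (cases q) (simp_all add: surplus_def)
  then obtain a where "q = Suc a" using not0_implies_Suc by blast
  then show thesis using that[of a] q min by auto
qed

lemma last_peak:
  assumes "finite B" "finite C" "k > 0" "\<And>z. excess B C z \<le> k" "excess B C z = k"
  obtains p where "z \<le> p" "excess B C p = k" "\<And>y. y > p \<Longrightarrow> excess B C y < k"
proof -
  obtain l where l: "B \<subseteq> {..<l}" "C \<subseteq> {..<l}"
    using assms(1,2) finite_nat_iff_bounded[of "B \<union> C"] by auto
  have above: "y \<le> l" if "excess B C y = k" for y
  proof (rule ccontr)
    assume "\<not> y \<le> l"
    then have "excess B C y = 0" using l by (intro excess_beyond) auto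
    then show False using that assms(3) by simp
  qed
  define p where "p = (GREATEST y. excess B C y = k)"
  have p: "excess B C p = k" "\<And>y. excess B C y = k \<Longrightarrow> y \<le> p"
    using GreatestI_nat[of "\<lambda>y. excess B C y = k", OF assms(5) above]
      Greatest_le_nat[of "\<lambda>y. excess B C y = k", OF _ above] by (simp_all add: p_def)
  then have "excess B C y < k" if "y > p" for y
    using that assms(4)[of y] by (meson leD order_le_imp_less_or_eq)
  then show thesis using that p assms(5) by blast
qed

lemma covered_peak_iff_last_pivot:
  assumes fin: "finite B" "finite C" and disj: "A \<inter> B = {}" and "k > 0"
  shows "covered_peak k A B C \<longleftrightarrow> (\<exists>a p. last_pivot k A B C a p)"
proof
  assume "covered_peak k A B C"
  then obtain z where bound: "\<And>z. excess B C z \<le> k"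
    and z: "excess B C z = k" "covered A B z" unfolding covered_peak_def by blast
  obtain p where p: "z \<le> p" "excess B C p = k" "\<And>y. y > p \<Longrightarrow> excess B C y < k"
    using last_peak[OF fin \<open>k > 0\<close> bound z(1)] by blast
  obtain a where a: "a \<le> p" "\<And>v. lead A B a \<le> lead A B v"
    "\<And>v. a < v \<Longrightarrow> v \<le> p \<Longrightarrow> lead A B a < lead A B v"
    using covered_last_argmin[OF z(2) p(1)] by blast
  have "p \<in> B"
    using excess_Suc[OF fin, of p] p(2) p(3)[of "Suc p"] by (simp add: of_bool_def split: if_splits)
  then have "lead A B (Suc p) < lead A B p" using disj by (auto simp: lead_Suc)
  then have "a \<noteq> p" using a(2)[of "Suc p"] by auto
  then have "last_pivot k A B C a p"
    using a p(2,3) bound by (simp add: last_pivot_def pivot_def)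
  then show "\<exists>a p. last_pivot k A B C a p" by blast
next
  assume "\<exists>a p. last_pivot k A B C a p"
  then show "covered_peak k A B C" using covered_peak_if_pivot unfolding last_pivot_def by blast
qed

lemma covered_peak_iff_first_pivot:
  assumes fin: "finite A" "finite B" "finite C" and disj: "B \<inter> C = {}" and "card A < card B"
  shows "covered_peak k A B C \<longleftrightarrow> (\<exists>a p. first_pivot k A B C a p)"
proof
  assume "covered_peak k A B C"
  then obtain z where bound: "\<And>z. excess B C z \<le> k"
    and z: "excess B C z = k" "covered A B z" unfolding covered_peak_def by blast
  obtain a where a: "a < z" "\<And>v. lead A B (Suc a) \<le> lead A B v"
    "\<And>v. v \<le> a \<Longrightarrow> lead A B (Suc a) < lead A B v"
    using covered_first_argmin[OF z(2) fin(1,2) \<open>card A < card B\<close>] by blast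
  have "a \<in> B" using a(3)[of a] by (simp add: lead_Suc of_bool_def split: if_splits)
  then have "excess B C a = excess B C (Suc a) + 1"
    using excess_Suc[OF fin(2,3), of a] disj by auto
  then have "excess B C (Suc a) < k" using bound[of a] by simp
  define r where "r = (LEAST y. a < y \<and> excess B C y = k)"
  have r: "a < r" "excess B C r = k" and least: "\<And>y. a < y \<Longrightarrow> y < r \<Longrightarrow> excess B C y \<noteq> k"
    using LeastI[of "\<lambda>y. a < y \<and> excess B C y = k" z] not_less_Least z(1) a(1)
    by (auto simp: r_def)
  have "r \<noteq> Suc a" using r(2) \<open>excess B C (Suc a) < k\<close> by auto
  then obtain p where p: "r = Suc p" "a < p" using r(1) by (metis Suc_lessE Suc_lessI)
  have "excess B C y < k" if "a < y" "y \<le> p" for y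
    using that least[of y] bound[of y] p(1) by simp
  then show "\<exists>a p. first_pivot k A B C a p"
    using p r(2) bound a(2,3) unfolding first_pivot_def pivot_def by (metis Suc_less_eq)
next
  assume "\<exists>a p. first_pivot k A B C a p"
  then show "covered_peak k A B C" using covered_peak_if_pivot unfolding first_pivot_def by blast
qed

section \<open>Queues as partitions into three rows\<close>

definition leading :: "nat set \<Rightarrow> nat set \<Rightarrow> nat set" where
  "leading B C = {c \<in> C. \<forall>b\<in>B. c < b}"

definition row_partition :: "nat \<Rightarrow> nat \<Rightarrow> nat \<Rightarrow> nat set \<Rightarrow> nat set \<Rightarrow> nat set \<Rightarrow> bool" where
  "row_partition l s m A B C \<longleftrightarrow>
     A \<union> B \<union> C = {1..l} \<and> A \<inter> B = {} \<and> A \<inter> C = {} \<and> B \<inter> C = {} \<and> card A = s \<and> card B = m"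

definition queues :: "nat \<Rightarrow> nat \<Rightarrow> nat \<Rightarrow> nat \<Rightarrow> nat \<Rightarrow> (nat set \<times> nat set \<times> nat set) set" where
  "queues r k l s m = {(A, B, C).
     row_partition l s m A B C \<and> r \<le> card (leading B C) \<and> covered_peak (int k) A B C}"

definition pivoted_queues ::
    "nat \<Rightarrow> nat \<Rightarrow> nat \<Rightarrow> nat \<Rightarrow> nat \<Rightarrow> (nat set \<times> nat set \<times> nat set \<times> nat \<times> nat) set" where
  "pivoted_queues r k l s m = {(A, B, C, a, p).
     a \<notin> A \<union> B \<union> C \<and> p \<notin> A \<union> B \<union> C \<and>
     row_partition l (Suc s) (Suc m) (insert a A) (insert p B) C \<and>
     r \<le> card (leading (insert p B) C) \<and> pivot (int k) A B C a p}"

lemma row_partition_finite: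
  assumes "row_partition l s m A B C"
  shows "finite A" "finite B" "finite C"
proof -
  have "finite (A \<union> B \<union> C)" using assms by (simp add: row_partition_def)
  then show "finite A" "finite B" "finite C" by simp_all
qed

lemma row_partition_subset:
  assumes "row_partition l s m A B C"
  shows "A \<subseteq> {..<Suc l}" "B \<subseteq> {..<Suc l}" "C \<subseteq> {..<Suc l}"
proof -
  have "A \<union> B \<union> C = {1..l}" using assms by (simp add: row_partition_def)
  also have "\<dots> \<subseteq> {..<Suc l}" by auto
  finally show "A \<subseteq> {..<Suc l}" "B \<subseteq> {..<Suc l}" "C \<subseteq> {..<Suc l}" by simp_all
qed

lemma row_partition_disjoint:
  assumes "row_partition l s m A B C"
  shows "A \<inter> B = {}" "A \<inter> C = {}" "B \<inter> C = {}"
  using assms by (simp_all add: row_partition_def)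

lemma row_partition_shift_iff:
  assumes "a \<notin> A \<union> B \<union> C" "p \<notin> A \<union> B \<union> C" "a \<noteq> p"
  shows "row_partition l (Suc s) (Suc m) (insert a A) (insert p B) C \<longleftrightarrow>
    row_partition l s (Suc m) A (insert a B) (insert p C)"
proof (cases "finite A \<and> finite B")
  case True
  have "insert a A \<union> insert p B \<union> C = A \<union> insert a B \<union> insert p C" by blast
  moreover have "insert a A \<inter> insert p B = {} \<longleftrightarrow> A \<inter> insert a B = {}"
    "insert a A \<inter> C = {} \<longleftrightarrow> A \<inter> insert p C = {}" "insert p B \<inter> C = {} \<longleftrightarrow> insert a B \<inter> insert p C = {}"
    using assms by auto
  ultimately show ?thesis using True assms by (simp add: row_partition_def)
next
  case False
  then show ?thesis using row_partition_finite[of l] by (metis finite_insert)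
qed

lemma leading_shift:
  assumes "b \<in> B" "b < a" "b < p"
  shows "leading (insert p B) C = leading (insert a B) (insert p C)"
  using assms by (auto simp: leading_def)

lemma pivot_above_second_row:
  assumes "pivot k A B C a p" "finite A" "finite B" "card A < card B"
  obtains b where "b \<in> B" "b < a"
proof -
  obtain l where l: "A \<subseteq> {..<l}" "B \<subseteq> {..<l}"
    using assms(2,3) finite_nat_iff_bounded[of "A \<union> B"] by auto
  have "lead A B a \<le> lead A B l" using assms(1) by (simp add: pivot_def)
  also have "\<dots> < 0" using lead_beyond[OF l] assms(4) by simp
  finally have "card (B \<inter> {..<a}) > 0" unfolding surplus_def by linarith
  then have "B \<inter> {..<a} \<noteq> {}" using card_gt_0_iff by blast
  then show thesis using that by blast
qed

lemma pivoted_queues_last_iff: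
  "(A, B, C, a, p) \<in> pivoted_queues r k l s m \<longleftrightarrow>
     a \<notin> A \<union> B \<union> C \<and> p \<notin> A \<union> B \<union> C \<and>
     row_partition l (Suc s) (Suc m) (insert a A) (insert p B) C \<and>
     r \<le> card (leading (insert p B) C) \<and>
     last_pivot (int (Suc k)) (insert a A) (insert p B) C a p"
proof (cases "a \<notin> A \<and> p \<notin> B \<and> row_partition l (Suc s) (Suc m) (insert a A) (insert p B) C")
  case True
  then have "finite A" "finite B"
    using row_partition_finite[of l "Suc s" "Suc m" "insert a A" "insert p B" C] by simp_all
  then have "last_pivot (int (Suc k)) (insert a A) (insert p B) C a p \<longleftrightarrow> pivot (int k) A B C a p"
    using last_pivot_insert_iff[of A B a p "int k" C] True by (simp add: add.commute)
  then show ?thesis by (simp add: pivoted_queues_def)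
qed (auto simp: pivoted_queues_def)

lemma pivoted_queues_first_iff:
  assumes "s < m"
  shows "(A, B, C, a, p) \<in> pivoted_queues r k l s m \<longleftrightarrow>
     a \<notin> A \<union> B \<union> C \<and> p \<notin> A \<union> B \<union> C \<and>
     row_partition l s (Suc m) A (insert a B) (insert p C) \<and>
     r \<le> card (leading (insert a B) (insert p C)) \<and>
     first_pivot (int k) A (insert a B) (insert p C) a p"
proof (cases "a \<notin> A \<union> B \<union> C \<and> p \<notin> A \<union> B \<union> C \<and> a < p \<and>
    row_partition l s (Suc m) A (insert a B) (insert p C)")
  case True
  then have fin: "finite A" "finite B" "finite C"
    using row_partition_finite[of l s "Suc m" A "insert a B" "insert p C"] by simp_all
  then have "card A < card B" using True assms by (auto simp: row_partition_def)
  then have "leading (insert p B) C = leading (insert a B) (insert p C)"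
    if "pivot (int k) A B C a p"
    using pivot_above_second_row[OF that fin(1,2)] leading_shift True by (metis less_trans)
  moreover have "first_pivot (int k) A (insert a B) (insert p C) a p \<longleftrightarrow> pivot (int k) A B C a p"
    using True fin by (intro first_pivot_insert_iff) auto
  ultimately show ?thesis
    using True row_partition_shift_iff[of a A B C p l s m] by (auto simp: pivoted_queues_def)
next
  case False
  then show ?thesis using row_partition_shift_iff[of a A B C p l s m]
    by (auto simp: pivoted_queues_def pivot_def first_pivot_def)
qed

lemma card_queues_last_pivot:
  "card (queues r (Suc k) l (Suc s) (Suc m)) = card (pivoted_queues r k l s m)"
proof -
  define f :: "nat set \<times> nat set \<times> nat set \<times> nat \<times> nat \<Rightarrow> nat set \<times> nat set \<times> nat set" where
    "f = (\<lambda>(A, B, C, a, p). (insert a A, insert p B, C))"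
  have "bij_betw f (pivoted_queues r k l s m) (queues r (Suc k) l (Suc s) (Suc m))"
  proof (rule bij_betwI')
    fix x y assume mem: "x \<in> pivoted_queues r k l s m" "y \<in> pivoted_queues r k l s m"
    obtain A B C a p A' B' C' a' p' where xy: "x = (A, B, C, a, p)" "y = (A', B', C', a', p')"
      by (cases x; cases y)
    have "a = a' \<and> p = p'" if "f x = f y"
      using last_pivot_unique mem that unfolding xy pivoted_queues_last_iff
      by (auto simp: f_def)
    then show "f x = f y \<longleftrightarrow> x = y"
      using mem unfolding xy pivoted_queues_last_iff by (auto simp: f_def insert_ident)
  next
    fix x assume "x \<in> pivoted_queues r k l s m"
    then show "f x \<in> queues r (Suc k) l (Suc s) (Suc m)"
      using covered_peak_if_pivot pivoted_queues_last_iff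
      by (cases x) (simp add: f_def queues_def last_pivot_def, blast)
  next
    fix q assume "q \<in> queues r (Suc k) l (Suc s) (Suc m)"
    then obtain A B C where q: "q = (A, B, C)" and part: "row_partition l (Suc s) (Suc m) A B C"
      and lead: "r \<le> card (leading B C)" and peak: "covered_peak (int (Suc k)) A B C"
      by (auto simp: queues_def)
    note fin = row_partition_finite[OF part] and disj = row_partition_disjoint[OF part]
    obtain a p where last: "last_pivot (int (Suc k)) A B C a p"
      using covered_peak_iff_last_pivot[OF fin(2,3) disj(1)] peak by auto
    note mem = last_pivot_mem[OF fin(2,3) last]
    then have AB: "insert a (A - {a}) = A" "insert p (B - {p}) = B" by blast+
    have "(A - {a}, B - {p}, C, a, p) \<in> pivoted_queues r k l s m"
      using part lead last mem disj unfolding pivoted_queues_last_iff AB by blast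
    moreover have "q = f (A - {a}, B - {p}, C, a, p)" using AB by (simp add: q f_def)
    ultimately show "\<exists>x\<in>pivoted_queues r k l s m. q = f x" by blast
  qed
  then show ?thesis by (simp add: bij_betw_same_card)
qed

lemma card_queues_first_pivot:
  assumes "s < m"
  shows "card (queues r k l s (Suc m)) = card (pivoted_queues r k l s m)"
proof -
  note first_iff = pivoted_queues_first_iff[OF assms]
  define f :: "nat set \<times> nat set \<times> nat set \<times> nat \<times> nat \<Rightarrow> nat set \<times> nat set \<times> nat set" where
    "f = (\<lambda>(A, B, C, a, p). (A, insert a B, insert p C))"
  have "bij_betw f (pivoted_queues r k l s m) (queues r k l s (Suc m))"
  proof (rule bij_betwI')
    fix x y assume mem: "x \<in> pivoted_queues r k l s m" "y \<in> pivoted_queues r k l s m"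
    obtain A B C a p A' B' C' a' p' where xy: "x = (A, B, C, a, p)" "y = (A', B', C', a', p')"
      by (cases x; cases y)
    have "a = a' \<and> p = p'" if "f x = f y"
      using first_pivot_unique mem that unfolding xy first_iff
      by (auto simp: f_def)
    then show "f x = f y \<longleftrightarrow> x = y"
      using mem unfolding xy first_iff by (auto simp: f_def insert_ident)
  next
    fix x assume "x \<in> pivoted_queues r k l s m"
    then show "f x \<in> queues r k l s (Suc m)"
      using covered_peak_if_pivot first_iff
      by (cases x) (simp add: f_def queues_def first_pivot_def, blast)
  next
    fix q assume "q \<in> queues r k l s (Suc m)"
    then obtain A B C where q: "q = (A, B, C)" and part: "row_partition l s (Suc m) A B C"
      and lead: "r \<le> card (leading B C)" and peak: "covered_peak (int k) A B C"
      by (auto simp: queues_def)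
    note fin = row_partition_finite[OF part] and disj = row_partition_disjoint[OF part]
    have "card A < card B" using part assms by (simp add: row_partition_def)
    then obtain a p where first: "first_pivot (int k) A B C a p"
      using covered_peak_iff_first_pivot[OF fin disj(3)] peak by blast
    note mem = first_pivot_mem[OF fin(2,3) first]
    then have BC: "insert a (B - {a}) = B" "insert p (C - {p}) = C" by blast+
    have "(A, B - {a}, C - {p}, a, p) \<in> pivoted_queues r k l s m"
      using part lead first mem disj unfolding first_iff BC by blast
    moreover have "q = f (A, B - {a}, C - {p}, a, p)" using BC by (simp add: q f_def)
    ultimately show "\<exists>x\<in>pivoted_queues r k l s m. q = f x" by blast
  qed
  then show ?thesis by (simp add: bij_betw_same_card)
qed

lemma card_queues_Suc:
  assumes "Suc s < m"
  shows "card (queues r (Suc k) l (Suc s) m) = card (queues r k l s m)"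
proof -
  obtain m' where "m = Suc m'" "s < m'" using assms by (cases m) auto
  then show ?thesis using card_queues_last_pivot card_queues_first_pivot by simp
qed

lemma queues_without_first_row: "queues r (Suc k) l 0 m = {}"
proof -
  have False if "(A, B, C) \<in> queues r (Suc k) l 0 m" for A B C
  proof -
    have part: "row_partition l 0 m A B C" and peak: "covered_peak (int (Suc k)) A B C"
      using that by (auto simp: queues_def)
    note fin = row_partition_finite[OF part]
    have "A = {}" using part fin(1) by (simp add: row_partition_def)
    moreover have "\<exists>a p. last_pivot (int (Suc k)) A B C a p"
      using covered_peak_iff_last_pivot[OF fin(2,3) row_partition_disjoint(1)[OF part]] peak by simp
    ultimately show False using last_pivot_mem(1)[OF fin(2,3)] by blast
  qed
  then show ?thesis by auto
qed

lemma covered_peak_insert_last: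
  assumes "B \<subseteq> {..<N}" "C \<subseteq> {..<N}" "k > 0"
  shows "covered_peak k A B (insert N C) \<longleftrightarrow> covered_peak (k + 1) A B C"
proof -
  have "finite C" "N \<notin> C" using assms(2) finite_subset by auto
  then have "excess B (insert N C) z = excess B C z - of_bool (z \<le> N)" for z
    by (simp add: surplus_insert_right)
  moreover have "excess B C z = 0" if "\<not> z \<le> N" for z
    using assms(1,2) that by (intro excess_beyond) auto
  ultimately have "excess B (insert N C) z \<le> k \<longleftrightarrow> excess B C z \<le> k + 1"
    "excess B (insert N C) z = k \<longleftrightarrow> excess B C z = k + 1" for z
    using assms(3) by (cases "z \<le> N"; fastforce)+
  then show ?thesis by (simp add: covered_peak_def)
qed

lemma row_partition_insert_last_iff:
  assumes "Suc l \<notin> C"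
  shows "row_partition (Suc l) s m A B (insert (Suc l) C) \<longleftrightarrow> row_partition l s m A B C"
proof
  assume part: "row_partition (Suc l) s m A B (insert (Suc l) C)"
  have "A \<union> B \<union> C = A \<union> B \<union> insert (Suc l) C - {Suc l}"
    using row_partition_disjoint[OF part] assms by blast
  also have "\<dots> = {1..l}" using part by (auto simp: row_partition_def)
  finally show "row_partition l s m A B C" using part by (auto simp: row_partition_def)
next
  assume part: "row_partition l s m A B C"
  then have "A \<union> B \<union> insert (Suc l) C = {1..Suc l}"
    by (auto simp: row_partition_def atLeastAtMostSuc_conv)
  then show "row_partition (Suc l) s m A B (insert (Suc l) C)"
    using part row_partition_subset[OF part] by (auto simp: row_partition_def)
qed

lemma queues_insert_last_iff:
  assumes "m > 0" "k > 0" "Suc l \<notin> C"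
  shows "(A, B, insert (Suc l) C) \<in> queues r k (Suc l) s m \<longleftrightarrow> (A, B, C) \<in> queues r (Suc k) l s m"
proof (cases "row_partition l s m A B C")
  case True
  note sub = row_partition_subset[OF True]
  have "B \<noteq> {}" using True assms(1) by (auto simp: row_partition_def)
  then have "leading B (insert (Suc l) C) = leading B C"
    using sub(2) by (fastforce simp: leading_def)
  moreover have "covered_peak (int k) A B (insert (Suc l) C) \<longleftrightarrow> covered_peak (int (Suc k)) A B C"
    using covered_peak_insert_last[OF sub(2,3), of "int k" A] assms(2) by (simp add: add.commute)
  ultimately show ?thesis
    using row_partition_insert_last_iff[OF assms(3)] by (simp add: queues_def)
qed (simp add: queues_def row_partition_insert_last_iff[OF assms(3)])

lemma card_queues_remove_last:
  assumes "m > 0" "k > 0"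
  shows "card {(A, B, C) \<in> queues r k (Suc l) s m. Suc l \<in> C} = card (queues r (Suc k) l s m)"
proof -
  note insert_iff = queues_insert_last_iff[OF assms]
  have last: "Suc l \<notin> C" if "(A, B, C) \<in> queues r (Suc k) l s m" for A B C
    using that row_partition_subset(3)[of l] by (fastforce simp: queues_def)
  have "bij_betw (\<lambda>(A, B, C). (A, B, insert (Suc l) C)) (queues r (Suc k) l s m)
      {(A, B, C) \<in> queues r k (Suc l) s m. Suc l \<in> C}"
  proof (rule bij_betw_byWitness[where f' = "\<lambda>(A, B, C). (A, B, C - {Suc l})"])
    have "(A, B, C - {Suc l}) \<in> queues r (Suc k) l s m"
      if "(A, B, C) \<in> queues r k (Suc l) s m" "Suc l \<in> C" for A B C
      using insert_iff[of l "C - {Suc l}" A B] that by (simp add: insert_absorb)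
    then show "(\<lambda>(A, B, C). (A, B, C - {Suc l})) ` {(A, B, C) \<in> queues r k (Suc l) s m. Suc l \<in> C}
        \<subseteq> queues r (Suc k) l s m" by auto
  qed (use insert_iff last in auto)
  then show ?thesis by (simp add: bij_betw_same_card)
qed

section \<open>Ballot subsets and two-row tableaux\<close>

definition ballot_subsets :: "('a \<Rightarrow> 'a \<Rightarrow> bool) \<Rightarrow> 'a set \<Rightarrow> nat \<Rightarrow> 'a set set" where
  "ballot_subsets le X m = {R. R \<subseteq> X \<and> card R = m \<and>
     (\<forall>r\<in>R. card {x \<in> R. le x r} \<le> card {x \<in> X - R. le x r})}"

lemma card_ballot_subsets_iso:
  assumes e: "bij_betw e X Y" and iso: "\<And>x y. x \<in> X \<Longrightarrow> y \<in> X \<Longrightarrow> le' (e x) (e y) \<longleftrightarrow> le x y"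
  shows "card (ballot_subsets le' Y m) = card (ballot_subsets le X m)"
proof -
  have inj: "inj_on e X" and Y: "Y = e ` X" using e by (simp_all add: bij_betw_def)
  have card_e: "card (e ` S) = card S" if "S \<subseteq> X" for S
    using inj_on_subset[OF inj that] by (rule card_image)
  have below: "card {y \<in> e ` S. le' y (e r)} = card {x \<in> S. le x r}" if "S \<subseteq> X" "r \<in> X" for S r
  proof -
    have "{y \<in> e ` S. le' y (e r)} = e ` {x \<in> S. le x r}" using iso that by auto
    then show ?thesis using card_e[of "{x \<in> S. le x r}"] that(1) by auto
  qed
  have image_iff: "e ` R \<in> ballot_subsets le' Y m \<longleftrightarrow> R \<in> ballot_subsets le X m" if R: "R \<subseteq> X" for R
  proof -
    have "Y - e ` R = e ` (X - R)" using inj R by (simp add: Y inj_on_image_set_diff)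
    then have "card {y \<in> Y - e ` R. le' y (e r)} = card {x \<in> X - R. le x r}" if "r \<in> R" for r
      using below[of "X - R" r] R that by auto
    moreover have "card {y \<in> e ` R. le' y (e r)} = card {x \<in> R. le x r}" if "r \<in> R" for r
      using below[OF R, of r] R that by blast
    ultimately show ?thesis using R card_e[OF R] by (auto simp: ballot_subsets_def Y)
  qed
  have "ballot_subsets le' Y m = (`) e ` ballot_subsets le X m"
  proof (intro equalityI subsetI)
    fix S assume S: "S \<in> ballot_subsets le' Y m"
    then have "S \<subseteq> e ` X" by (simp add: ballot_subsets_def Y)
    then obtain R where "R \<subseteq> X" "S = e ` R" by (rule subset_imageE)
    then show "S \<in> (`) e ` ballot_subsets le X m" using S image_iff by blast
  next
    fix S assume "S \<in> (`) e ` ballot_subsets le X m"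
    then obtain R where R: "R \<in> ballot_subsets le X m" "S = e ` R" by blast
    then have "R \<subseteq> X" by (simp add: ballot_subsets_def)
    then show "S \<in> ballot_subsets le' Y m" using image_iff R by blast
  qed
  moreover have "inj_on ((`) e) (ballot_subsets le X m)"
    using inj by (intro inj_on_subset[OF inj_on_image_Pow]) (auto simp: ballot_subsets_def)
  ultimately show ?thesis using card_image by metis
qed

lemma card_ballot_subsets_reverse:
  fixes X :: "nat set"
  assumes "finite X" "card X = q"
  shows "card (ballot_subsets (\<ge>) X m) = card (ballot_subsets (\<le>) {1..q} m)"
proof -
  obtain h where h: "bij_betw h {..<q} X" "strict_mono_on {..<q} h"
    using ex_bij_betw_strict_mono_card[OF assms(1)] assms(2) by metis
  have "bij_betw (\<lambda>i. q - i) {1..q} {..<q}"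
    by (rule bij_betw_byWitness[where f' = "\<lambda>i. q - i"]) auto
  then have "bij_betw (h \<circ> (\<lambda>i. q - i)) {1..q} X" using h(1) by (rule bij_betw_trans)
  then show ?thesis
  proof (rule card_ballot_subsets_iso)
    fix i j assume "i \<in> {1..q}" "j \<in> {1..q}"
    then show "(h \<circ> (\<lambda>i. q - i)) i \<ge> (h \<circ> (\<lambda>i. q - i)) j \<longleftrightarrow> i \<le> j"
      using strict_mono_on_less_eq[OF h(2), of "q - j" "q - i"] by auto
  qed
qed

lemma leading_ballot_subsets_remove_Min:
  fixes X :: "nat set"
  assumes "finite X" "X \<noteq> {}"
  shows "{B \<in> ballot_subsets (\<ge>) X m. Suc r \<le> card (leading B (X - B))} =
    {B \<in> ballot_subsets (\<ge>) (X - {Min X}) m. r \<le> card (leading B (X - {Min X} - B))}"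
proof -
  define x where "x = Min X"
  have x: "x \<in> X" "\<And>y. y \<in> X \<Longrightarrow> x \<le> y" using assms by (simp_all add: x_def)
  have free: "x \<notin> B" if B: "B \<subseteq> X" "Suc r \<le> card (leading B (X - B))" for B
  proof -
    have "leading B (X - B) \<noteq> {}" using B(2) by force
    then obtain c where "c \<in> X" "\<forall>b\<in>B. c < b" by (auto simp: leading_def)
    then show ?thesis using x(2)[of c] by force
  qed
  have "B \<in> ballot_subsets (\<ge>) X m \<and> Suc r \<le> card (leading B (X - B)) \<longleftrightarrow>
      B \<in> ballot_subsets (\<ge>) (X - {x}) m \<and> r \<le> card (leading B (X - {x} - B))" for B
  proof (cases "B \<subseteq> X - {x}")
    case True
    then have above: "x < b" if "b \<in> B" for b
      using x(2)[of b] that by (metis Diff_iff insertI1 order_le_less subsetD)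
    then have "leading B (X - B) = insert x (leading B (X - {x} - B))"
      using x(1) True by (auto simp: leading_def)
    then have "card (leading B (X - B)) = Suc (card (leading B (X - {x} - B)))"
      using assms(1) by (simp add: leading_def)
    moreover have "{y \<in> X - B. b \<le> y} = {y \<in> X - {x} - B. b \<le> y}" if "b \<in> B" for b
      using above[OF that] by auto
    moreover have "B \<subseteq> X" using True by blast
    ultimately show ?thesis using True by (simp add: ballot_subsets_def)
  next
    case False
    then show ?thesis using free[of B] unfolding ballot_subsets_def by blast
  qed
  then show ?thesis unfolding x_def[symmetric] by simp
qed

lemma card_leading_ballot_subsets:
  fixes X :: "nat set"
  assumes "finite X" "card X = q + r"
  shows "card {B \<in> ballot_subsets (\<ge>) X m. r \<le> card (leading B (X - B))} =
    card (ballot_subsets (\<le>) {1..q} m)"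
  using assms
proof (induction r arbitrary: X)
  case 0
  then show ?case using card_ballot_subsets_reverse[of X q m] by simp
next
  case (Suc r)
  have "X \<noteq> {}" using Suc.prems by auto
  then have "card (X - {Min X}) = q + r" using Suc.prems by simp
  then show ?case
    using Suc.IH[of "X - {Min X}"] Suc.prems
      leading_ballot_subsets_remove_Min[OF _ \<open>X \<noteq> {}\<close>] by simp
qed

lemma excess_le_0_iff:
  assumes "finite B" "finite C"
  shows "(\<forall>z. excess B C z \<le> 0) \<longleftrightarrow> (\<forall>b\<in>B. card {x \<in> B. b \<le> x} \<le> card {x \<in> C. b \<le> x})"
proof (intro iffI ballI allI)
  fix b assume "\<forall>z. excess B C z \<le> 0" "b \<in> B"
  then have "card (B \<inter> {b..}) \<le> card (C \<inter> {b..})" by (simp add: surplus_def)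
  then show "card {x \<in> B. b \<le> x} \<le> card {x \<in> C. b \<le> x}" by (simp add: Int_def)
next
  fix z assume elementwise: "\<forall>b\<in>B. card {x \<in> B. b \<le> x} \<le> card {x \<in> C. b \<le> x}"
  show "excess B C z \<le> 0"
  proof (cases "B \<inter> {z..} = {}")
    case False
    define b where "b = Min (B \<inter> {z..})"
    have b: "b \<in> B \<inter> {z..}" "\<And>x. x \<in> B \<inter> {z..} \<Longrightarrow> b \<le> x"
      using Min_in[OF _ False] assms(1) by (simp_all add: b_def)
    have "card (B \<inter> {z..}) \<le> card {x \<in> B. b \<le> x}"
      using b(2) assms(1) by (intro card_mono) auto
    also have "\<dots> \<le> card {x \<in> C. b \<le> x}" using elementwise b(1) by blast
    also have "\<dots> \<le> card (C \<inter> {z..})" using b(1) assms(2) by (intro card_mono) auto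
    finally show ?thesis by (simp add: surplus_def)
  qed (simp add: surplus_def)
qed

lemma card_le_eq_card_indices:
  assumes "distinct xs"
  shows "card {x \<in> set xs. x \<le> y} = card {i. i < length xs \<and> xs ! i \<le> y}"
proof -
  have "{x \<in> set xs. x \<le> y} = (!) xs ` {i. i < length xs \<and> xs ! i \<le> y}"
    by (auto simp: in_set_conv_nth)
  moreover have "inj_on ((!) xs) {i. i < length xs \<and> xs ! i \<le> y}"
    using assms by (intro inj_on_nth) auto
  ultimately show ?thesis by (simp add: card_image)
qed

lemma nth_le_iff_less_card:
  fixes xs :: "'a :: linorder list"
  assumes "sorted_wrt (<) xs" "j < length xs"
  shows "xs ! j \<le> y \<longleftrightarrow> j < card {x \<in> set xs. x \<le> y}"
proof -
  let ?I = "{i. i < length xs \<and> xs ! i \<le> y}"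
  have mono: "xs ! i \<le> xs ! k" if "i \<le> k" "k < length xs" for i k
    using assms(1) that strict_sorted_imp_sorted sorted_nth_mono by blast
  have "xs ! j \<le> y \<longleftrightarrow> j < card ?I"
  proof
    assume "xs ! j \<le> y"
    then have "{..j} \<subseteq> ?I" using mono assms(2) by fastforce
    then have "card {..j} \<le> card ?I" by (intro card_mono) auto
    then show "j < card ?I" by simp
  next
    assume less: "j < card ?I"
    show "xs ! j \<le> y"
    proof (rule ccontr)
      assume "\<not> xs ! j \<le> y"
      then have "\<not> j \<le> i" if "i \<in> ?I" for i using that mono[of j i] by (auto dest: order.trans)
      then have "?I \<subseteq> {..<j}" by (auto simp: not_le)
      then have "card ?I \<le> j" using card_mono[of "{..<j}" ?I] by simp
      then show False using less by simp
    qed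
  qed
  then show ?thesis using card_le_eq_card_indices[of xs y] assms(1) by (simp add: strict_sorted_iff)
qed

lemma card_le_nth:
  fixes xs :: "'a :: linorder list"
  assumes "sorted_wrt (<) xs" "j < length xs"
  shows "card {x \<in> set xs. x \<le> xs ! j} = Suc j"
proof -
  have "xs ! i \<le> xs ! j \<longleftrightarrow> i \<le> j" if "i < length xs" for i
    using assms that
    by (cases i j rule: linorder_cases) (auto simp: sorted_wrt_iff_nth_less less_imp_le not_le)
  then have "{i. i < length xs \<and> xs ! i \<le> xs ! j} = {..j}" using assms(2) by auto
  then show ?thesis using card_le_eq_card_indices[of xs] assms(1) by (simp add: strict_sorted_iff)
qed

lemma columns_increasing_iff:
  fixes xs ys :: "'a :: linorder list"
  assumes "sorted_wrt (<) xs" "sorted_wrt (<) ys" "set xs \<inter> set ys = {}" "length ys \<le> length xs"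
  shows "(\<forall>j<length ys. xs ! j < ys ! j) \<longleftrightarrow>
    (\<forall>y\<in>set ys. card {x \<in> set ys. x \<le> y} \<le> card {x \<in> set xs. x \<le> y})"
proof -
  have "xs ! j < ys ! j \<longleftrightarrow> card {x \<in> set ys. x \<le> ys ! j} \<le> card {x \<in> set xs. x \<le> ys ! j}"
    if j: "j < length ys" for j
  proof -
    have "xs ! j \<noteq> ys ! j" using assms(3,4) j by (metis disjoint_iff nth_mem order_less_le_trans)
    then have "xs ! j < ys ! j \<longleftrightarrow> xs ! j \<le> ys ! j" by auto
    also have "\<dots> \<longleftrightarrow> j < card {x \<in> set xs. x \<le> ys ! j}"
      using assms(1,4) j by (intro nth_le_iff_less_card) auto
    finally show ?thesis using card_le_nth[OF assms(2) j] by (simp add: Suc_le_eq)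
  qed
  then show ?thesis by (simp add: all_set_conv_all_nth)
qed

lemma is_SYT_two_rows_iff:
  "is_SYT [p, m] T \<longleftrightarrow> (\<exists>xs ys. T = [xs, ys] \<and> length xs = p \<and> length ys = m \<and>
     sorted_wrt (<) xs \<and> sorted_wrt (<) ys \<and> (\<forall>j<m. xs ! j < ys ! j) \<and>
     set xs \<inter> set ys = {} \<and> set xs \<union> set ys = {1..p + m})"
proof (cases "\<exists>xs ys. T = [xs, ys]")
  case True
  then obtain xs ys where T: "T = [xs, ys]" by blast
  have "(\<forall>i j. Suc i < length T \<and> j < length (T ! Suc i) \<longrightarrow> T ! i ! j < T ! Suc i ! j) \<longleftrightarrow>
    (\<forall>j<length ys. xs ! j < ys ! j)" unfolding T by (auto simp: less_Suc_eq)
  then show ?thesis unfolding is_SYT_def by (auto simp: T strict_sorted_iff)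
next
  case False
  then have "map length T \<noteq> [p, m]" by (auto simp: map_eq_Cons_conv)
  then show ?thesis using False unfolding is_SYT_def by blast
qed

definition two_row_tableau :: "nat \<Rightarrow> nat set \<Rightarrow> nat list list" where
  "two_row_tableau N R = [sorted_list_of_set ({1..N} - R), sorted_list_of_set R]"

lemma is_SYT_two_row_tableau:
  assumes "m \<le> p" "R \<in> ballot_subsets (\<le>) {1..p + m} m"
  shows "is_SYT [p, m] (two_row_tableau (p + m) R)"
proof -
  define xs ys where "xs = sorted_list_of_set ({1..p + m} - R)" and "ys = sorted_list_of_set R"
  have sub: "R \<subseteq> {1..p + m}" "card R = m" using assms(2) by (simp_all add: ballot_subsets_def)
  then have "finite R" using finite_subset by blast
  then have sets: "set xs = {1..p + m} - R" "set ys = R" and len: "length xs = p" "length ys = m"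
    and sorted: "sorted_wrt (<) xs" "sorted_wrt (<) ys"
    using sub by (simp_all add: xs_def ys_def card_Diff_subset)
  have disj: "set xs \<inter> set ys = {}" and "set xs \<union> set ys = {1..p + m}" using sub sets by auto
  moreover have "\<forall>j<m. xs ! j < ys ! j"
    using columns_increasing_iff[OF sorted disj] assms len by (simp add: sets ballot_subsets_def)
  moreover have "two_row_tableau (p + m) R = [xs, ys]"
    by (simp add: two_row_tableau_def xs_def ys_def)
  ultimately show ?thesis using len sorted disj unfolding is_SYT_two_rows_iff by blast
qed

lemma two_row_tableau_of_SYT:
  assumes "m \<le> p" "is_SYT [p, m] T"
  obtains R where "R \<in> ballot_subsets (\<le>) {1..p + m} m" "T = two_row_tableau (p + m) R"
proof -
  obtain xs ys where T: "T = [xs, ys]" and len: "length xs = p" "length ys = m"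
    and sorted: "sorted_wrt (<) xs" "sorted_wrt (<) ys" and less: "\<forall>j<m. xs ! j < ys ! j"
    and disj: "set xs \<inter> set ys = {}" and un: "set xs \<union> set ys = {1..p + m}"
    using assms(2) unfolding is_SYT_two_rows_iff by blast
  have xs: "{1..p + m} - set ys = set xs" using disj un by blast
  have "card (set ys) = m" using len(2) sorted(2) by (simp add: distinct_card strict_sorted_iff)
  moreover have "\<forall>y\<in>set ys. card {x \<in> set ys. x \<le> y} \<le> card {x \<in> set xs. x \<le> y}"
    using columns_increasing_iff[OF sorted disj] less len assms(1) by simp
  ultimately have "set ys \<in> ballot_subsets (\<le>) {1..p + m} m"
    using un unfolding ballot_subsets_def mem_Collect_eq xs by blast
  moreover have "T = two_row_tableau (p + m) (set ys)"
    unfolding T two_row_tableau_def xs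
    using sorted by (simp add: strict_sorted_iff sorted_list_of_set.idem_if_sorted_distinct)
  ultimately show thesis by (rule that)
qed

lemma num_SYT_two_rows:
  assumes "m \<le> p"
  shows "num_SYT [p, m] = card (ballot_subsets (\<le>) {1..p + m} m)"
proof -
  have "finite R" if "R \<in> ballot_subsets (\<le>) {1..p + m} m" for R
    using that finite_subset by (auto simp: ballot_subsets_def)
  then have "inj_on (two_row_tableau (p + m)) (ballot_subsets (\<le>) {1..p + m} m)"
    by (intro inj_onI) (simp add: two_row_tableau_def sorted_list_of_set_inject)
  moreover have "two_row_tableau (p + m) ` ballot_subsets (\<le>) {1..p + m} m = {T. is_SYT [p, m] T}"
    using is_SYT_two_row_tableau[OF assms] two_row_tableau_of_SYT[OF assms] by blast
  ultimately show ?thesis unfolding num_SYT_def using card_image by metis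
qed

section \<open>Counting queues\<close>

lemma queues_0_iff:
  "(A, B, C) \<in> queues r 0 l s m \<longleftrightarrow> A \<subseteq> {1..l} \<and> card A = s \<and> C = {1..l} - A - B \<and>
     B \<in> ballot_subsets (\<ge>) ({1..l} - A) m \<and> r \<le> card (leading B ({1..l} - A - B))"
proof (cases "row_partition l s m A B C")
  case True
  note fin = row_partition_finite[OF True]
  note sub = row_partition_subset[OF True]
  have C: "C = {1..l} - A - B" and AB: "A \<subseteq> {1..l}" "B \<subseteq> {1..l} - A" "card A = s" "card B = m"
    using True unfolding row_partition_def by blast+
  have "covered A B (Suc l)"
    unfolding covered_def
  proof (intro exI[of _ "Suc l"] conjI allI impI order_refl)
    fix v assume "Suc l \<le> v"
    then show "lead A B (Suc l) \<le> lead A B v"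
      using lead_beyond[of A "Suc l" B] lead_beyond[of A v B] sub by fastforce
  qed
  then have "covered_peak 0 A B C \<longleftrightarrow> (\<forall>z. excess B C z \<le> 0)"
    using excess_beyond[OF sub(2,3)] unfolding covered_peak_def by blast
  then show ?thesis using True AB excess_le_0_iff[OF fin(2,3)]
    by (auto simp: queues_def ballot_subsets_def C)
next
  case False
  then have "\<not> (A \<subseteq> {1..l} \<and> card A = s \<and> C = {1..l} - A - B \<and> B \<subseteq> {1..l} - A \<and> card B = m)"
    unfolding row_partition_def by blast
  then show ?thesis using False by (auto simp: queues_def ballot_subsets_def)
qed

lemma card_queues_0:
  assumes "l = p + r + s + m" "m \<le> p"
  shows "card (queues r 0 l s m) = (l choose s) * num_SYT [p, m]"
proof -
  define \<A> where "\<A> = {A. A \<subseteq> {1..l} \<and> card A = s}"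
  define \<B> where "\<B> A = {B \<in> ballot_subsets (\<ge>) ({1..l} - A) m.
    r \<le> card (leading B ({1..l} - A - B))}" for A
  have "bij_betw (\<lambda>(A, B, C). (A, B)) (queues r 0 l s m) (SIGMA A:\<A>. \<B> A)"
    by (rule bij_betw_byWitness[where f' = "\<lambda>(A, B). (A, B, {1..l} - A - B)"])
      (auto simp: queues_0_iff \<A>_def \<B>_def subset_eq)
  then have "card (queues r 0 l s m) = card (SIGMA A:\<A>. \<B> A)" by (rule bij_betw_same_card)
  also have "\<dots> = (\<Sum>A\<in>\<A>. card (\<B> A))"
  proof (rule card_SigmaI)
    show "finite \<A>" by (simp add: \<A>_def)
    have "\<B> A \<subseteq> Pow {1..l}" for A by (auto simp: \<B>_def ballot_subsets_def)
    then show "\<forall>A\<in>\<A>. finite (\<B> A)" using finite_subset by blast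
  qed
  also have "\<dots> = (\<Sum>A\<in>\<A>. num_SYT [p, m])"
  proof (rule sum.cong)
    fix A assume "A \<in> \<A>"
    then have "card ({1..l} - A) = p + m + r"
      using assms(1) finite_subset[of A "{1..l}"] by (simp add: \<A>_def card_Diff_subset)
    then show "card (\<B> A) = num_SYT [p, m]"
      using card_leading_ballot_subsets[of "{1..l} - A"] num_SYT_two_rows[OF assms(2)]
      by (simp add: \<B>_def)
  qed simp
  also have "\<dots> = (l choose s) * num_SYT [p, m]"
    using n_subsets[of "{1..l}" s] by (simp add: \<A>_def)
  finally show ?thesis .
qed

lemma card_queues:
  assumes "l + k = p + r + s + m" "m \<le> p" "s < m"
  shows "card (queues r k l s m) = binom l (int s - int k) * num_SYT [p, m]"
  using assms
proof (induction k arbitrary: s)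
  case 0
  then show ?case using card_queues_0 by (simp add: binom_def)
next
  case (Suc k)
  show ?case
  proof (cases s)
    case 0
    then show ?thesis by (simp add: queues_without_first_row binom_def)
  next
    case s: (Suc s')
    then have "card (queues r (Suc k) l s m) = card (queues r k l s' m)"
      using card_queues_Suc Suc.prems(3) by simp
    also have "\<dots> = binom l (int s' - int k) * num_SYT [p, m]"
      using Suc.IH Suc.prems s by simp
    finally show ?thesis by (simp add: s)
  qed
qed

section \<open>Multiline queues\<close>

lemma is_cmlq_iff:
  "is_cmlq s t u (as, bs, cs) \<longleftrightarrow>
     sorted_wrt (<) as \<and> sorted_wrt (<) bs \<and> sorted_wrt (<) cs \<and>
     row_partition (3 * s + 2 * t + u) s (s + t) (set as) (set bs) (set cs)"
    (is "_ \<longleftrightarrow> ?as \<and> ?bs \<and> ?cs \<and> ?part")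
proof (cases "?as \<and> ?bs \<and> ?cs")
  case True
  then have dist: "distinct as" "distinct bs" "distinct cs" by (auto simp: strict_sorted_iff)
  note len = dist[THEN distinct_card]
  show ?thesis
  proof
    assume "is_cmlq s t u (as, bs, cs)"
    then show "?as \<and> ?bs \<and> ?cs \<and> ?part" by (auto simp: is_cmlq_def row_partition_def len Un_assoc)
  next
    assume "?as \<and> ?bs \<and> ?cs \<and> ?part"
    then have part: ?part by simp
    have "card (set as \<union> set bs \<union> set cs) = length as + length bs + length cs"
      using row_partition_disjoint[OF part] by (simp add: card_Un_disjoint Int_Un_distrib2 len)
    moreover have "card (set as \<union> set bs \<union> set cs) = 3 * s + 2 * t + u"
      using part by (simp add: row_partition_def)
    ultimately have sum: "length as + length bs + length cs = 3 * s + 2 * t + u" by simp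
    moreover have "length as = s" "length bs = s + t"
      using part len by (simp_all add: row_partition_def)
    ultimately have "length cs = s + t + u" by simp
    then show "is_cmlq s t u (as, bs, cs)"
      using True dist part sum by (auto simp: is_cmlq_def row_partition_def len Un_assoc)
  qed
qed (auto simp: is_cmlq_def)

lemma row2_transition:
  assumes "is_cmlq s t u (as, bs, cs)"
  defines "paths \<equiv> row2_first (as, bs, cs) @ row2_second (as, bs, cs)"
  shows "transition as (set bs)" "set paths = set bs" "transition paths (set cs)"
proof -
  have len: "length as = s" "length bs = s + t" "length cs = s + t + u"
    and dist: "distinct as" "distinct bs" "distinct cs"
    and disj: "set as \<inter> set bs = {}" "set bs \<inter> set cs = {}"
    using assms(1) by (auto simp: is_cmlq_def)
  show tr: "transition as (set bs)"
    using len dist disj by (simp add: transition_def distinct_card)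
  have first: "set (row2_first (as, bs, cs)) \<subseteq> set bs" "distinct (row2_first (as, bs, cs))"
    using bully_targets_transition[OF tr] by (simp_all add: row2_first_def)
  then show set: "set paths = set bs" by (auto simp: paths_def row2_second_def)
  have "distinct paths" using first(2) dist(2) by (auto simp: paths_def row2_second_def)
  moreover have "length paths = s + t"
    using distinct_card[OF \<open>distinct paths\<close>] distinct_card[OF dist(2)] set len(2) by simp
  ultimately show "transition paths (set cs)"
    using disj(2) len dist(3) set by (simp add: transition_def distinct_card)
qed

lemma wrappings23_conv_num_wrappings:
  "wrappings23 (as, bs, cs) =
     num_wrappings (row2_first (as, bs, cs) @ row2_second (as, bs, cs)) (set cs)"
  by (simp add: wrappings23_def endpoints1_def num_wrappings_append)

lemma projected_word_nth_iff:
  assumes "i < length cs"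
  shows "projected_word (as, bs, cs) ! i = 1 \<longleftrightarrow>
      cs ! i \<in> set (bully_targets (row2_first (as, bs, cs)) (set cs))"
    "projected_word (as, bs, cs) ! i = 3 \<longleftrightarrow>
      cs ! i \<notin> set (bully_targets (row2_first (as, bs, cs) @ row2_second (as, bs, cs)) (set cs))"
  using assms
  by (simp_all add: projected_word_def endpoints1_def endpoints2_def bully_targets_append)

lemma two_le_card_leading_iff:
  assumes "finite C" "C \<inter> {..c2} = {c1, c2}" "c1 < c2"
  shows "2 \<le> card (leading B C) \<longleftrightarrow> (\<forall>b\<in>B. c2 < b)"
proof
  assume two: "2 \<le> card (leading B C)"
  show "\<forall>b\<in>B. c2 < b"
  proof (rule ccontr)
    assume "\<not> (\<forall>b\<in>B. c2 < b)"
    then obtain b where "b \<in> B" "b \<le> c2" by (auto simp: not_less)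
    then have "leading B C \<subseteq> C \<inter> {..c2} - {c2}" by (fastforce simp: leading_def)
    also have "\<dots> = {c1}" using assms(2,3) by auto
    finally have "card (leading B C) \<le> card {c1}" by (intro card_mono) auto
    then show False using two by simp
  qed
next
  assume "\<forall>b\<in>B. c2 < b"
  moreover have "{c1, c2} \<subseteq> C" using assms(2) by blast
  ultimately have "{c1, c2} \<subseteq> leading B C" using assms(3) by (auto simp: leading_def)
  then have "card {c1, c2} \<le> card (leading B C)"
    using assms(1) by (intro card_mono) (auto simp: leading_def)
  then show "2 \<le> card (leading B C)" using assms(3) by simp
qed

lemma word_13_iff:
  assumes q: "is_cmlq s t u (as, bs, cs)" and "t > 0" "u > 0"
  shows "wrappings23 (as, bs, cs) = 1 \<and> projected_word (as, bs, cs) ! 0 = 1 \<and>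
      projected_word (as, bs, cs) ! 1 = 3 \<longleftrightarrow>
    2 \<le> card (leading (set bs) (set cs)) \<and> covered_peak 1 (set as) (set bs) (set cs)"
    (is "?word \<longleftrightarrow> _")
proof -
  define xs ys where "xs = row2_first (as, bs, cs)" and "ys = row2_second (as, bs, cs)"
  note transitions = row2_transition[OF q, folded xs_def ys_def]
  have "length cs \<ge> 2" using q assms(2,3) by (auto simp: is_cmlq_def)
  then obtain c1 c2 cs' where cs: "cs = c1 # c2 # cs'"
    by (metis Suc_le_length_iff numeral_2_eq_2)
  have "sorted_wrt (<) cs" using q by (simp add: is_cmlq_def)
  then have c: "set cs \<inter> {..c2} = {c1, c2}" "c1 < c2" by (auto simp: cs)
  have wrap: "wrappings23 (as, bs, cs) = num_wrappings (xs @ ys) (set cs)"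
    by (simp add: wrappings23_conv_num_wrappings xs_def ys_def)
  have "projected_word (as, bs, cs) ! 0 = 1 \<longleftrightarrow> c1 \<in> set (bully_targets xs (set cs))"
    using projected_word_nth_iff(1)[of 0 cs] by (simp add: cs xs_def)
  moreover have "projected_word (as, bs, cs) ! 1 = 3 \<longleftrightarrow> c2 \<notin> set (bully_targets (xs @ ys) (set cs))"
    using projected_word_nth_iff(2)[of 1 cs] by (simp add: cs xs_def ys_def)
  ultimately have "?word \<longleftrightarrow> (num_wrappings (xs @ ys) (set cs) = 1 \<and> num_wrappings xs (set cs) = 1) \<and>
      (\<forall>b\<in>set bs. c2 < b)"
    using first_letters_iff[OF transitions(3) c] wrap transitions(2) by auto
  also have "(\<forall>b\<in>set bs. c2 < b) \<longleftrightarrow> 2 \<le> card (leading (set bs) (set cs))"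
    using two_le_card_leading_iff[OF _ c] by simp
  also have "num_wrappings (xs @ ys) (set cs) = 1 \<and> num_wrappings xs (set cs) = 1 \<longleftrightarrow>
      (\<forall>z. excess (set bs) (set cs) z \<le> 1) \<and>
      (\<exists>z. excess (set bs) (set cs) z = 1 \<and> set bs \<inter> {z..} \<subseteq> set xs)"
    using num_wrappings_prefix_iff[OF transitions(3), of 1] transitions(2) by simp
  also have "\<dots> \<longleftrightarrow> covered_peak 1 (set as) (set bs) (set cs)"
  proof -
    have "length as < card (set bs)" using q assms(2) by (auto simp: is_cmlq_def distinct_card)
    then have "set bs \<inter> {z..} \<subseteq> set xs \<longleftrightarrow> covered (set as) (set bs) z" for z
      using bully_targets_cover_iff[OF transitions(1)] by (simp add: xs_def row2_first_def)
    then show ?thesis by (simp add: covered_peak_def)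
  qed
  finally show ?thesis by blast
qed

lemma bij_betw_sorted_rows:
  assumes "\<And>A B C. (A, B, C) \<in> Q \<Longrightarrow> finite A \<and> finite B \<and> finite C"
  shows "bij_betw (\<lambda>(as, bs, cs). (set as, set bs, set cs))
    {(as, bs, cs). sorted_wrt (<) as \<and> sorted_wrt (<) bs \<and> sorted_wrt (<) cs \<and>
      (set as, set bs, set cs) \<in> Q} (Q :: (nat set \<times> nat set \<times> nat set) set)"
  by (rule bij_betw_byWitness[where
        f' = "\<lambda>(A, B, C). (sorted_list_of_set A, sorted_list_of_set B, sorted_list_of_set C)"])
    (use assms in \<open>auto simp: strict_sorted_iff sorted_list_of_set.idem_if_sorted_distinct\<close>)

lemma beta13_eq_card_queues:
  assumes "t > 0" "n > s + t" "Suc l = n + 2 * s + t"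
  shows "beta13 s t n = card (queues 2 2 l s (s + t))"
proof -
  define u where "u = n - s - t"
  define Q where "Q = {(A, B, C) \<in> queues 2 1 (Suc l) s (s + t). Suc l \<in> C}"
  define M where "M = {(as, bs, cs). sorted_wrt (<) as \<and> sorted_wrt (<) bs \<and> sorted_wrt (<) cs \<and>
    (set as, set bs, set cs) \<in> Q}"
  have "u > 0" "3 * s + 2 * t + u = Suc l" using assms(2,3) by (simp_all add: u_def)
  then have "is_cmlq s t u (as, bs, cs) \<and> Suc l \<in> set cs \<and> wrappings23 (as, bs, cs) = 1 \<and>
      projected_word (as, bs, cs) ! 0 = 1 \<and> projected_word (as, bs, cs) ! 1 = 3 \<longleftrightarrow>
    (as, bs, cs) \<in> M" for as bs cs
    using word_13_iff[of s t u as bs cs] is_cmlq_iff[of s t u as bs cs] assms(1)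
    by (auto simp: M_def Q_def queues_def)
  then have "beta13 s t n = card M" by (simp add: beta13_def assms(3) u_def)
  also have "\<dots> = card Q"
    unfolding M_def using row_partition_finite
    by (intro bij_betw_same_card[OF bij_betw_sorted_rows]) (auto simp: Q_def queues_def)
  also have "\<dots> = card (queues 2 2 l s (s + t))"
    using card_queues_remove_last[of "s + t" 1 2 l s] assms(1) by (simp add: Q_def numeral_2_eq_2)
  finally show ?thesis .
qed

theorem theorem5p4:
  fixes s t n N :: nat
  assumes "s \<ge> 1" and "t \<ge> 1" and "n > s + t" and "N = n + 2 * s + t"
  shows "beta13 s t n = binom (N - 1) (int s - 2) * num_SYT [n - 1, s + t]"
proof -
  have "beta13 s t n = card (queues 2 2 (N - 1) s (s + t))"
    using assms by (intro beta13_eq_card_queues) auto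
  also have "\<dots> = binom (N - 1) (int s - int 2) * num_SYT [n - 1, s + t]"
    using assms by (intro card_queues) auto
  finally show ?thesis by simp
qed

end
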